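(* Let $r\in\{1,2,3,\dots\}\cup\{\infty\}$, let $M,\widetilde M\subset\mathbb{R}^m$ be two embedded manifolds of class $C^r$, both of dimension $p$, with $x^0\in M\cap\widetilde M$, and let $k$ be an integer with $1\le k\le r$. Then $M$ and $\widetilde M$ have at $x^0$ the order of tangency at least $k$ if and only if there exist $C^r$ parametrizations $q:(U,u^0)\to(M,x^0)$ and $\tilde q:(U,u^0)\to(\widetilde M,x^0)$ of the vicinities of $x^0$ in $M$ and $\widetilde M$, respectively (defined on a common neighbourhood $U$ of a point $u^0\in\mathbb{R}^p$), such that $$\mathcal{G}^{(k)}q\,(u^0)=\mathcal{G}^{(k)}\tilde q\,(u^0).$$
   Context: Order of tangency: let $M,\widetilde M\subset\mathbb{R}^m$ be embedded manifolds of class $C^r$, $r\ge 1$, of the same dimension $p$, with $x^0\in M\cap\widetilde M$, and let $k\le r$ be a (finite) non-negative integer. One says that $M$ and $\widetilde M$ have at $x^0$ the order of tangency at least $k$ if there exist a point $u^0\in\mathbb{R}^p$, a neighbourhood $U\ni u^0$ in $\mathbb{R}^p$, and $C^r$ parametrizations (diffeomorphisms onto their images, which are neighbourhoods of $x^0$ in $M$, respectively $\widetilde M$) $q:(U,u^0)\to(M,x^0)$ and $\tilde q:(U,u^0)\to(\widetilde M,x^0)$, with $q(u^0)=x^0=\tilde q(u^0)$, such that $(\tilde q-q)(u)=o(|u-u^0|^k)$ when $U\ni u\to u^0$. Grassmann image map: for a $C^1$ immersion $H:N\to N'$ of an $n$-dimensional manifold $N$ into an $n'$-dimensional manifold $N'$,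 let $G_n(N')$ denote the total space of the Grassmann bundle over $N'$ whose fibre over a point is the set of all $n$-dimensional linear subspaces of the tangent space of $N'$ at that point; $G_n(N')$ is a manifold of dimension $n'+n(n'-n)$. Define $\mathcal{G}H:N\to G_n(N')$ by $\mathcal{G}H(s)=dH(s)(T_sN)$, an $n$-plane in $T_{H(s)}N'$ (so the point $\mathcal{G}H(s)$ lies over $H(s)$). Tower: put $M^{(0)}=\mathbb{R}^m$ and $M^{(l)}=G_p(M^{(l-1)})$ for $l\ge 1$. For a $C^r$ parametrization $q:U\to M\subset\mathbb{R}^m$ (viewed as an immersion into $\mathbb{R}^m$), put $\mathcal{G}^{(1)}q=\mathcal{G}q:U\to G_p(\mathbb{R}^m)=M^{(1)}$ and recursively $\mathcal{G}^{(l+1)}q=\mathcal{G}(\mathcal{G}^{(l)}q)$, so that $\mathcal{G}^{(l)}q:U\to G_p(M^{(l-1)})=M^{(l)}$; these maps are defined for $1\le l\le r$ ($l$ finite). The same definitions apply to $\tilde q$. *)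

theory Defs
  imports "HOL-Analysis.Analysis" "HOL-Library.Extended_Nat" "HOL-Library.Landau_Symbols"
begin

section \<open>Maps of class \<open>C\<^sup>r\<close> and embedded manifolds\<close>

text \<open>
  \<open>C\<^sup>n\<close> on an open set: all iterated directional derivatives up to order \<open>n\<close> exist as Frechet
  derivatives and are continuous.
\<close>

fun Ck_on :: "nat \<Rightarrow> ('a::euclidean_space \<Rightarrow> 'b::euclidean_space) \<Rightarrow> 'a set \<Rightarrow> bool" where
  "Ck_on 0 f S \<longleftrightarrow> continuous_on S f"
| "Ck_on (Suc n) f S \<longleftrightarrow>
     (\<forall>x\<in>S. f differentiable (at x)) \<and> (\<forall>v. Ck_on n (\<lambda>x. frechet_derivative f (at x) v) S)"

text \<open>
  A map on an arbitrary set is of class \<open>C\<^sup>r\<close> if it extends, locally around each point of the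
  set, to a \<open>C\<^sup>r\<close> map on an open set. The value \<open>r = \<infinity>\<close> is allowed.
\<close>

definition Cr_on :: "enat \<Rightarrow> ('a::euclidean_space \<Rightarrow> 'b::euclidean_space) \<Rightarrow> 'a set \<Rightarrow> bool" where
  "Cr_on r f A \<longleftrightarrow>
     (\<forall>x\<in>A. \<exists>V g. open V \<and> x \<in> V \<and> (\<forall>n. enat n \<le> r \<longrightarrow> Ck_on n g V) \<and> (\<forall>y\<in>A \<inter> V. g y = f y))"

definition Cr_diffeomorphism ::
    "enat \<Rightarrow> ('a::euclidean_space \<Rightarrow> 'b::euclidean_space) \<Rightarrow> 'a set \<Rightarrow> 'b set \<Rightarrow> bool" where
  "Cr_diffeomorphism r f A B \<longleftrightarrow>
     bij_betw f A B \<and> Cr_on r f A \<and> Cr_on r (inv_into A f) B"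

text \<open>
  \<open>q : (U, u0) \<rightarrow> (M, x0)\<close>: a \<open>C\<^sup>r\<close> diffeomorphism of an open neighbourhood \<open>U\<close> of \<open>u0\<close> onto a
  relatively open neighbourhood of \<open>x0\<close> in \<open>M\<close>.
\<close>

definition Cr_parametrization ::
    "enat \<Rightarrow> (real^'p \<Rightarrow> real^'m) \<Rightarrow> (real^'p) set \<Rightarrow> real^'p \<Rightarrow> (real^'m) set \<Rightarrow> real^'m \<Rightarrow> bool"
  where
  "Cr_parametrization r q U u0 M x0 \<longleftrightarrow>
     open U \<and> u0 \<in> U \<and> q u0 = x0 \<and>
     openin (top_of_set M) (q ` U) \<and> Cr_diffeomorphism r q U (q ` U)"

text \<open>The dimension of the manifold is \<open>CARD('p)\<close>.\<close>

definition embedded_manifold :: "'p::finite itself \<Rightarrow> enat \<Rightarrow> (real^'m) set \<Rightarrow> bool" where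
  "embedded_manifold _ r M \<longleftrightarrow>
     (\<forall>x\<in>M. \<exists>(q :: real^'p \<Rightarrow> real^'m) U u. Cr_parametrization r q U u M x)"

definition tangency_order_at_least ::
    "'p::finite itself \<Rightarrow> enat \<Rightarrow> nat \<Rightarrow> (real^'m) set \<Rightarrow> (real^'m) set \<Rightarrow> real^'m \<Rightarrow> bool" where
  "tangency_order_at_least _ r k M M' x0 \<longleftrightarrow>
     (\<exists>(u0 :: real^'p) U q q'.
        Cr_parametrization r q U u0 M x0 \<and> Cr_parametrization r q' U u0 M' x0 \<and>
        (\<lambda>u. norm (q' u - q u)) \<in> o[at u0 within U](\<lambda>u. norm (u - u0) ^ k))"


section \<open>The tower of Grassmann bundles\<close>

text \<open>
  The tower over \<open>E\<^sub>0 = \<real>\<^sup>m\<close> is realized inside the Euclidean spaces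
  \<open>E\<^bsub>l+1\<^esub> = E\<^sub>l \<times> End(E\<^sub>l)\<close>: if \<open>X \<subseteq> E\<^sub>l\<close> is a submanifold, a point \<open>(x, W)\<close> of \<open>G\<^sub>p(X)\<close>, where
  \<open>W\<close> is a \<open>p\<close>-dimensional subspace of \<open>T\<^sub>xX \<subseteq> E\<^sub>l\<close>, is sent to \<open>x\<close> together with the matrix of
  the orthogonal projection of \<open>E\<^sub>l\<close> onto \<open>W\<close>. This is the standard embedding of the Grassmann
  bundle, and it is used only to give the bundle its smooth structure, that is, to make sense of
  differentials of maps into it and of its tangent vectors.

  As \<open>l\<close> is a variable, \<open>E\<^sub>l\<close> cannot be a type. It is represented by the functions
  \<open>'m coord \<Rightarrow> real\<close> that vanish outside the finite set \<open>coords l\<close>.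
\<close>

datatype 'm coord = Base 'm | Pull "'m coord" | Entry "'m coord" "'m coord"

fun coords :: "nat \<Rightarrow> 'm coord set" where
  "coords 0 = range Base"
| "coords (Suc l) = Pull ` coords l \<union> (\<lambda>(a, b). Entry a b) ` (coords l \<times> coords l)"

text \<open>
  \<open>Plane x W\<close> is the plane \<open>W\<close> (a set of tangent vectors at \<open>x\<close>) regarded as a point lying over
  \<open>x\<close>.
\<close>

datatype 'm gpoint = Point "real^'m" | Plane "'m gpoint" "('m coord \<Rightarrow> real) set"

fun level :: "'m::finite gpoint \<Rightarrow> nat" where
  "level (Point x) = 0"
| "level (Plane x W) = Suc (level x)"

text \<open>Orthogonal projection onto a subspace \<open>W\<close> of \<open>\<real>\<^sup>I\<close>, for finite \<open>I\<close>.\<close>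

definition orth_proj :: "'c set \<Rightarrow> ('c \<Rightarrow> real) set \<Rightarrow> ('c \<Rightarrow> real) \<Rightarrow> ('c \<Rightarrow> real)" where
  "orth_proj I W x = (THE y. y \<in> W \<and> (\<forall>w\<in>W. (\<Sum>c\<in>I. (x c - y c) * w c) = 0))"

fun embed :: "'m::finite gpoint \<Rightarrow> 'm coord \<Rightarrow> real" where
  "embed (Point x) (Base i) = x $ i"
| "embed (Point x) (Pull c) = 0"
| "embed (Point x) (Entry a b) = 0"
| "embed (Plane x W) (Base i) = 0"
| "embed (Plane x W) (Pull c) = embed x c"
| "embed (Plane x W) (Entry a b) =
     orth_proj (coords (level x)) W (\<lambda>c. if c = b then 1 else 0) a"

text \<open>The differential at \<open>s\<close> of a map into the tower, with values in \<open>E\<^sub>l\<close>.\<close>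

definition differential ::
    "(real^'p::finite \<Rightarrow> 'm::finite gpoint) \<Rightarrow> real^'p \<Rightarrow> real^'p \<Rightarrow> ('m coord \<Rightarrow> real)" where
  "differential H s v = (\<lambda>c. frechet_derivative (\<lambda>u. embed (H u) c) (at s) v)"

definition grassmann_image ::
    "(real^'p::finite \<Rightarrow> 'm::finite gpoint) \<Rightarrow> real^'p \<Rightarrow> 'm gpoint" where
  "grassmann_image H s = Plane (H s) (range (differential H s))"

primrec grassmann_iter ::
    "nat \<Rightarrow> (real^'p::finite \<Rightarrow> real^'m::finite) \<Rightarrow> real^'p \<Rightarrow> 'm gpoint" where
  "grassmann_iter 0 q = (\<lambda>u. Point (q u))"
| "grassmann_iter (Suc l) q = grassmann_image (grassmann_iter l q)"

text \<open>
  The manifolds \<open>M\<^sup>(\<^sup>l\<^sup>)\<close> themselves, in which \<open>grassmann_iter l q\<close> takes its values. Tangent vectors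
  are the velocities of curves.
\<close>

definition tangent_space :: "'m::finite gpoint set \<Rightarrow> 'm gpoint \<Rightarrow> ('m coord \<Rightarrow> real) set" where
  "tangent_space X x =
     {w. \<exists>\<gamma>. (\<forall>t. \<gamma> t \<in> X) \<and> \<gamma> 0 = x \<and>
            (\<forall>c. ((\<lambda>t. embed (\<gamma> t) c) has_real_derivative w c) (at 0))}"

definition is_plane :: "'p::finite itself \<Rightarrow> ('c \<Rightarrow> real) set \<Rightarrow> bool" where
  "is_plane _ W \<longleftrightarrow> (\<exists>L :: real^'p \<Rightarrow> 'c \<Rightarrow> real. (\<forall>c. linear (\<lambda>v. L v c)) \<and> inj L \<and> W = range L)"

primrec tower :: "'p::finite itself \<Rightarrow> nat \<Rightarrow> 'm::finite gpoint set" where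
  "tower p 0 = range Point"
| "tower p (Suc l) = {Plane x W | x W. x \<in> tower p l \<and> is_plane p W \<and> W \<subseteq> tangent_space (tower p l) x}"


section \<open>The iterated Grassmann images of a parametrization lie in the tower\<close>

text \<open>
  For a \<open>C\<^sup>r\<close> parametrization \<open>q\<close> and \<open>l \<le> r\<close>, all differentials involved exist and are injective,
  and \<open>grassmann_iter l q\<close> takes its values in \<open>tower TYPE('p) l\<close>. This is the final lemma of the
  section.
\<close>

lemma Ck_on_cong:
  assumes "open S" "\<And>x. x \<in> S \<Longrightarrow> f x = g x" "Ck_on n f S"
  shows "Ck_on n g S"
  using assms(2,3)
proof (induction n arbitrary: f g)
  case 0
  then show ?case using continuous_on_cong[of S S f g] by simp
next
  case (Suc n)
  have d: "g differentiable (at x)" "frechet_derivative f (at x) = frechet_derivative g (at x)"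
    if "x \<in> S" for x
  proof -
    have fx: "(f has_derivative frechet_derivative f (at x)) (at x)"
      using Suc.prems(2) that unfolding Ck_on.simps(2) frechet_derivative_works by simp
    have gx: "(g has_derivative frechet_derivative f (at x)) (at x)"
      by (rule has_derivative_transform_within_open[OF fx assms(1) that Suc.prems(1)])
    show "frechet_derivative f (at x) = frechet_derivative g (at x)"
      by (rule frechet_derivative_at[OF gx])
    show "g differentiable (at x)" by (rule differentiableI[OF gx])
  qed
  have "Ck_on n (\<lambda>x. frechet_derivative g (at x) v) S" for v
  proof (rule Suc.IH)
    show "Ck_on n (\<lambda>x. frechet_derivative f (at x) v) S" using Suc.prems(2) by simp
  qed (simp add: d(2))
  then show ?case using d(1) by simp
qed

lemma Ck_on_SucD: "Ck_on (Suc n) f S \<Longrightarrow> Ck_on n f S"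
proof (induction n arbitrary: f)
  case 0
  then show ?case
    by (auto intro!: continuous_at_imp_continuous_on differentiable_imp_continuous_within)
next
  case (Suc n)
  have "\<forall>x\<in>S. f differentiable (at x)" using Suc.prems unfolding Ck_on.simps(2)[of "Suc n"] by blast
  moreover have "Ck_on n (\<lambda>x. frechet_derivative f (at x) v) S" for v
    using Suc.prems Suc.IH unfolding Ck_on.simps(2)[of "Suc n"] by blast
  ultimately show ?case by simp
qed

lemma Ck_on_le: "Ck_on n f S \<Longrightarrow> k \<le> n \<Longrightarrow> Ck_on k f S"
  by (induction n) (auto simp: le_Suc_eq dest: Ck_on_SucD simp del: Ck_on.simps)

lemma Ck_on_const: "Ck_on n (\<lambda>x. c) S"
  by (induction n arbitrary: c) auto

lemma Ck_on_SucI: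
  assumes "open S" "\<And>x. x \<in> S \<Longrightarrow> (f has_derivative D x) (at x)" "\<And>v. Ck_on n (\<lambda>x. D x v) S"
  shows "Ck_on (Suc n) f S"
proof -
  have "Ck_on n (\<lambda>x. frechet_derivative f (at x) v) S" for v
  proof (rule Ck_on_cong[OF assms(1) _ assms(3)])
    fix x assume "x \<in> S"
    then show "D x v = frechet_derivative f (at x) v"
      using frechet_derivative_at[OF assms(2)] by simp
  qed
  moreover have "f differentiable (at x)" if "x \<in> S" for x
    using assms(2)[OF that] by (rule differentiableI)
  ultimately show ?thesis unfolding Ck_on.simps(2) by simp
qed

lemma Ck_on_SucE:
  assumes "Ck_on (Suc n) f S"
  shows "x \<in> S \<Longrightarrow> (f has_derivative frechet_derivative f (at x)) (at x)"
    "Ck_on n (\<lambda>x. frechet_derivative f (at x) v) S"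
  using assms unfolding Ck_on.simps(2) frechet_derivative_works by simp_all

lemma Ck_on_add:
  assumes "open S" "Ck_on n f S" "Ck_on n g S"
  shows "Ck_on n (\<lambda>x. f x + g x) S"
  using assms(2,3)
proof (induction n arbitrary: f g)
  case 0
  then show ?case by (auto intro: continuous_intros)
next
  case (Suc n)
  show ?case
    by (rule Ck_on_SucI[OF assms(1) has_derivative_add])
       (rule Ck_on_SucE[OF Suc.prems(1)] Ck_on_SucE[OF Suc.prems(2)] Suc.IH | assumption)+
qed

lemma Ck_on_mult:
  fixes f g :: "'a::euclidean_space \<Rightarrow> real"
  assumes "open S" "Ck_on n f S" "Ck_on n g S"
  shows "Ck_on n (\<lambda>x. f x * g x) S"
  using assms(2,3)
proof (induction n arbitrary: f g)
  case 0
  then show ?case by (auto intro: continuous_intros)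
next
  case (Suc n)
  show ?case
    by (rule Ck_on_SucI[OF assms(1) has_derivative_mult])
       (rule Ck_on_SucE[OF Suc.prems(1)] Ck_on_SucE[OF Suc.prems(2)] Ck_on_add[OF assms(1)] Suc.IH
          Ck_on_SucD[OF Suc.prems(1)] Ck_on_SucD[OF Suc.prems(2)] | assumption)+
qed

lemma Ck_on_inverse:
  fixes f :: "'a::euclidean_space \<Rightarrow> real"
  assumes "open S" "Ck_on n f S" "\<And>x. x \<in> S \<Longrightarrow> f x \<noteq> 0"
  shows "Ck_on n (\<lambda>x. inverse (f x)) S"
  using assms(2)
proof (induction n)
  case 0
  then show ?case using assms(3) by (auto intro: continuous_intros)
next
  case (Suc n)
  have d: "((\<lambda>x. inverse (f x)) has_derivative
     (\<lambda>v. (-1) * (inverse (f x) * frechet_derivative f (at x) v * inverse (f x)))) (at x)" if "x \<in> S" for x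
    using Deriv.has_derivative_inverse[OF assms(3)[OF that] Ck_on_SucE(1)[OF Suc.prems that]] by simp
  have i: "Ck_on n (\<lambda>x. inverse (f x)) S" using Suc.IH Ck_on_SucD[OF Suc.prems] by simp
  show ?case
    by (rule Ck_on_SucI[OF assms(1) d])
       (assumption | intro Ck_on_mult[OF assms(1)] Ck_on_const i Ck_on_SucE(2)[OF Suc.prems])+
qed

lemma Ck_on_sum:
  assumes "open S" "\<And>i. i \<in> I \<Longrightarrow> Ck_on n (f i) S"
  shows "Ck_on n (\<lambda>x. \<Sum>i\<in>I. f i x) S"
  using assms(2) by (induction I rule: infinite_finite_induct)
    (auto intro: Ck_on_const Ck_on_add[OF assms(1)] simp del: Ck_on.simps)

lemma Ck_on_prod:
  fixes f :: "'i \<Rightarrow> 'a::euclidean_space \<Rightarrow> real"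
  assumes "open S" "\<And>i. i \<in> I \<Longrightarrow> Ck_on n (f i) S"
  shows "Ck_on n (\<lambda>x. \<Prod>i\<in>I. f i x) S"
  using assms(2) by (induction I rule: infinite_finite_induct)
    (auto intro: Ck_on_const Ck_on_mult[OF assms(1)] simp del: Ck_on.simps)

lemma Ck_on_det:
  fixes A :: "'a::euclidean_space \<Rightarrow> real^'n^'n"
  assumes "open S" "\<And>i j. Ck_on n (\<lambda>x. A x $ i $ j) S"
  shows "Ck_on n (\<lambda>x. det (A x)) S"
  unfolding det_def
  by (intro Ck_on_sum Ck_on_mult Ck_on_prod Ck_on_const assms)

text \<open>
  The orthogonal projection onto the range of an injective linear map \<open>L\<close> exists, and is given by
  solving the normal equations with Cramer's rule. In particular the description used in
  \<open>orth_proj\<close> is a proper one for planes.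
\<close>

definition gram :: "'c set \<Rightarrow> (real^'p \<Rightarrow> 'c \<Rightarrow> real) \<Rightarrow> real^'p^'p" where
  "gram I L = (\<chi> i j. \<Sum>c\<in>I. L (axis i 1) c * L (axis j 1) c)"

definition gram_vec :: "'c set \<Rightarrow> (real^'p \<Rightarrow> 'c \<Rightarrow> real) \<Rightarrow> ('c \<Rightarrow> real) \<Rightarrow> real^'p" where
  "gram_vec I L x = (\<chi> i. \<Sum>c\<in>I. L (axis i 1) c * x c)"

lemma linear_axis_expand:
  fixes f :: "real^'p \<Rightarrow> real"
  assumes "linear f" shows "f v = (\<Sum>i\<in>UNIV. v $ i * f (axis i 1))"
proof -
  have "f v = f (\<Sum>i\<in>UNIV. v $ i *s axis i 1)" by (simp add: basis_expansion)
  also have "\<dots> = (\<Sum>i\<in>UNIV. v $ i * f (axis i 1))"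
    by (simp add: linear_sum[OF assms] scalar_mult_eq_scaleR linear_cmul[OF assms])
  finally show ?thesis .
qed

lemma gram_vec_apply:
  assumes "\<And>c. linear (\<lambda>v. L v c)"
  shows "(\<Sum>c\<in>I. x c * L v c) = v \<bullet> gram_vec I L x"
proof -
  have "(\<Sum>c\<in>I. x c * L v c) = (\<Sum>c\<in>I. x c * (\<Sum>i\<in>UNIV. v $ i * L (axis i 1) c))"
    by (rule sum.cong[OF refl]) (rule arg_cong2[where f="(*)", OF refl linear_axis_expand[OF assms]])
  also have "\<dots> = (\<Sum>i\<in>UNIV. \<Sum>c\<in>I. x c * (v $ i * L (axis i 1) c))"
    unfolding sum_distrib_left by (rule sum.swap)
  also have "\<dots> = (\<Sum>i\<in>UNIV. v $ i * (\<Sum>c\<in>I. L (axis i 1) c * x c))"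
    by (simp add: sum_distrib_left mult_ac)
  finally show ?thesis by (simp add: inner_vec_def gram_vec_def)
qed

lemma gram_apply:
  assumes "\<And>c. linear (\<lambda>v. L v c)"
  shows "gram I L *v z = gram_vec I L (L z)"
proof -
  have "(\<Sum>j\<in>UNIV. (\<Sum>c\<in>I. L (axis i 1) c * L (axis j 1) c) * z $ j)
     = (\<Sum>c\<in>I. L (axis i 1) c * L z c)" for i
  proof -
    have "(\<Sum>c\<in>I. L (axis i 1) c * L z c) = (\<Sum>c\<in>I. L (axis i 1) c * (\<Sum>j\<in>UNIV. z $ j * L (axis j 1) c))"
      by (rule sum.cong[OF refl]) (rule arg_cong2[where f="(*)", OF refl linear_axis_expand[OF assms]])
    also have "\<dots> = (\<Sum>j\<in>UNIV. \<Sum>c\<in>I. L (axis i 1) c * (z $ j * L (axis j 1) c))"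
      unfolding sum_distrib_left by (rule sum.swap)
    also have "\<dots> = (\<Sum>j\<in>UNIV. (\<Sum>c\<in>I. L (axis i 1) c * L (axis j 1) c) * z $ j)"
      by (simp add: sum_distrib_left sum_distrib_right mult_ac)
    finally show ?thesis by simp
  qed
  then show ?thesis by (simp add: vec_eq_iff gram_def gram_vec_def matrix_vector_mult_def)
qed

lemma orth_proj_range:
  fixes L :: "real^'p \<Rightarrow> 'c \<Rightarrow> real"
  assumes I: "finite I" and lin: "\<And>c. linear (\<lambda>v. L v c)" and inj: "inj L"
    and vanish: "\<And>v c. c \<notin> I \<Longrightarrow> L v c = 0"
  shows "det (gram I L) \<noteq> 0"
    and "orth_proj I (range L) x =
       L (\<chi> k. det(\<chi> i j. if j = k then gram_vec I L x $ i else gram I L $ i $ j) / det (gram I L))"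
proof -
  have L0: "L 0 = (\<lambda>c. 0)" by (rule ext) (rule linear_0[OF lin])
  have z: "y = 0" if "(\<Sum>c\<in>I. L y c * L y c) = 0" for y
  proof -
    have "\<forall>c\<in>I. L y c * L y c = 0" using that I by (subst (asm) sum_nonneg_eq_0_iff) simp_all
    then have "L y c = L 0 c" for c using vanish[where v = y and c = c] L0 by (cases "c \<in> I") simp_all
    then have "L y = L 0" by (rule ext)
    then show ?thesis using inj by (simp add: inj_eq)
  qed
  have "y = 0" if "gram I L *v y = 0" for y
  proof (rule z)
    have "(\<Sum>c\<in>I. L y c * L y c) = y \<bullet> gram_vec I L (L y)" by (rule gram_vec_apply[OF lin])
    also have "gram_vec I L (L y) = 0" using gram_apply[of L I y, OF lin] that by simp
    finally show "(\<Sum>c\<in>I. L y c * L y c) = 0" by simp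
  qed
  then have "invertible (gram I L)"
    unfolding invertible_left_inverse matrix_left_invertible_ker by simp
  then show d: "det (gram I L) \<noteq> 0" by (simp add: invertible_det_nz)
  define u where "u = (\<chi> k. det(\<chi> i j. if j = k then gram_vec I L x $ i else gram I L $ i $ j) / det (gram I L))"
  have uniq: "t = u \<longleftrightarrow> gram I L *v t = gram_vec I L x" for t
    unfolding u_def by (rule cramer[OF d, symmetric])
  have diff: "gram_vec I L (\<lambda>c. x c - y c) = gram_vec I L x - gram_vec I L y" for y x
    by (simp add: gram_vec_def vec_eq_iff algebra_simps sum_subtractf)
  have orth: "(\<Sum>c\<in>I. (x c - y c) * L v c) = v \<bullet> (gram_vec I L x - gram_vec I L y)" for y v
    using gram_vec_apply[where L = L and I = I and x = "\<lambda>c. x c - y c" and v = v, OF lin] unfolding diff .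
  have "orth_proj I (range L) x = L u" unfolding orth_proj_def
  proof (rule the_equality)
    have "gram_vec I L x = gram_vec I L (L u)" using uniq[of u] gram_apply[of L I u, OF lin] by simp
    then show "L u \<in> range L \<and> (\<forall>w\<in>range L. (\<Sum>c\<in>I. (x c - L u c) * w c) = 0)"
      using orth[of "L u"] by simp
    fix y assume y: "y \<in> range L \<and> (\<forall>w\<in>range L. (\<Sum>c\<in>I. (x c - y c) * w c) = 0)"
    then obtain t where t: "y = L t" by auto
    have "v \<bullet> (gram_vec I L x - gram_vec I L y) = 0" for v
      using y orth[of y v] by simp
    from this[of "gram_vec I L x - gram_vec I L y"] have "gram_vec I L x = gram_vec I L y" by simp
    then have "t = u" using uniq[of t] gram_apply[of L I t, OF lin] t by simp
    then show "y = L u" using t by simp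
  qed
  then show "orth_proj I (range L) x =
       L (\<chi> k. det(\<chi> i j. if j = k then gram_vec I L x $ i else gram I L $ i $ j) / det (gram I L))"
    unfolding u_def .
qed

lemma finite_coords: "finite (coords l :: 'm::finite coord set)" by (induction l) auto

text \<open>\<open>H\<close> takes values in level \<open>l\<close> and is of class \<open>C\<^sup>n\<close>.\<close>

definition smooth_level :: "nat \<Rightarrow> nat \<Rightarrow> (real^'p::finite \<Rightarrow> 'm::finite gpoint) \<Rightarrow> (real^'p) set \<Rightarrow> bool" where
  "smooth_level n l H U \<longleftrightarrow> (\<forall>u\<in>U. level (H u) = l) \<and> (\<forall>u\<in>U. \<forall>c. c \<notin> coords l \<longrightarrow> embed (H u) c = 0) \<and>
     (\<forall>c. Ck_on n (\<lambda>u. embed (H u) c) U)"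

lemma differential_props:
  assumes "open U" "u \<in> U" "smooth_level (Suc n) l H U"
  shows "linear (\<lambda>v. differential H u v c)" "c \<notin> coords l \<Longrightarrow> differential H u v c = 0"
    "((\<lambda>u. embed (H u) c) has_derivative (\<lambda>v. differential H u v c)) (at u)"
proof -
  have d: "(\<lambda>u. embed (H u) c) differentiable at u" for c
    using assms by (auto simp: smooth_level_def)
  show h: "((\<lambda>u. embed (H u) c) has_derivative (\<lambda>v. differential H u v c)) (at u)" for c
    unfolding differential_def using d by (simp add: frechet_derivative_works[symmetric])
  then show "linear (\<lambda>v. differential H u v c)" by (rule has_derivative_linear)
  assume "c \<notin> coords l"
  then have "((\<lambda>u. embed (H u) c) has_derivative (\<lambda>v. 0)) (at u)"
    using assms by (intro has_derivative_transform_within_open[OF has_derivative_const assms(1,2)]) (auto simp: smooth_level_def)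
  then show "differential H u v c = 0" using has_derivative_unique[OF h] by metis
qed

lemma smooth_level_step:
  fixes H :: "real^'p::finite \<Rightarrow> 'm::finite gpoint"
  assumes U: "open U" and g: "smooth_level (Suc n) l H U" and inj: "\<And>u. u \<in> U \<Longrightarrow> inj (differential H u)"
  shows "smooth_level n (Suc l) (grassmann_image H) U"
proof -
  note dp = differential_props[OF U _ g]
  have C: "Ck_on n (\<lambda>u. differential H u v c) U" for v c
    using g by (simp add: smooth_level_def differential_def)
  define pr where "pr u x = orth_proj (coords (level (H u))) (range (differential H u)) x" for u x
  have pr: "pr u x c = (\<Sum>k\<in>UNIV.
       (det(\<chi> i j. if j = k then gram_vec (coords l) (differential H u) x $ i else gram (coords l) (differential H u) $ i $ j) * inverse (det (gram (coords l) (differential H u))))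
        * differential H u (axis k 1) c)" (is "_ = ?f x c u")
    and dz: "det (gram (coords l) (differential H u)) \<noteq> 0" if "u \<in> U" for u x c
  proof -
    have l: "level (H u) = l" using g that by (simp add: smooth_level_def)
    have vanish: "differential H u v c = 0" if "c \<notin> coords l" for v c
      by (rule dp(2)[OF \<open>u \<in> U\<close> that])
    have lin: "linear (\<lambda>v. differential H u v c)" for c by (rule dp(1)[OF that])
    show "det (gram (coords l) (differential H u)) \<noteq> 0"
      by (rule orth_proj_range(1)[OF finite_coords]) (rule lin inj[OF that] vanish | assumption)+
    have R: "orth_proj (coords l) (range (differential H u)) x = differential H u
       (\<chi> k. det(\<chi> i j. if j = k then gram_vec (coords l) (differential H u) x $ i
         else gram (coords l) (differential H u) $ i $ j) / det (gram (coords l) (differential H u)))"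
      by (rule orth_proj_range(2)[OF finite_coords]) (rule lin inj[OF that] vanish | assumption)+
    show "pr u x c = ?f x c u" unfolding pr_def l
      by (rule trans[OF fun_cong[OF R] trans[OF linear_axis_expand[OF lin]]])
         (simp only: vec_lambda_beta divide_inverse)
  qed
  have gC: "Ck_on n (\<lambda>u. gram (coords l) (differential H u) $ i $ j) U" for i j
    unfolding gram_def vec_lambda_beta by (intro Ck_on_sum Ck_on_mult C U)
  have gvC: "Ck_on n (\<lambda>u. gram_vec (coords l) (differential H u) x $ i) U" for i x
    unfolding gram_vec_def vec_lambda_beta by (intro Ck_on_sum Ck_on_mult C U Ck_on_const)
  have mC: "Ck_on n (\<lambda>u. (\<chi> i j. if j = k then gram_vec (coords l) (differential H u) x $ i
      else gram (coords l) (differential H u) $ i $ j) $ i $ j) U" for k i j x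
    using gC gvC by (cases "j = k") (simp_all del: Ck_on.simps)
  have "Ck_on n (?f x c) U" for x c
    by (intro Ck_on_sum Ck_on_mult C U Ck_on_inverse Ck_on_det dz gC mC)
  then have prC: "Ck_on n (\<lambda>u. pr u x c) U" for x c
    by (rule Ck_on_cong[OF U, rotated]) (rule pr[symmetric])
  have emb: "embed (grassmann_image H u) c = (case c of Base i \<Rightarrow> 0 | Pull c \<Rightarrow> embed (H u) c |
     Entry a b \<Rightarrow> pr u (\<lambda>c. if c = b then 1 else 0) a)" for u c
    by (cases c) (auto simp: grassmann_image_def pr_def)
  have "Ck_on n (\<lambda>u. embed (grassmann_image H u) c) U" for c
    unfolding emb using g prC by (cases c) (auto simp: smooth_level_def intro: Ck_on_const Ck_on_SucD simp del: Ck_on.simps)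
  moreover have "embed (grassmann_image H u) c = 0" if "u \<in> U" "c \<notin> coords (Suc l)" for u c
  proof (cases c)
    case (Entry a b)
    show ?thesis
    proof (cases "a \<in> coords l")
      case False
      then show ?thesis using Entry dp(2)[OF that(1) False] pr[OF that(1)] by (simp add: emb)
    next
      case True
      then have "b \<notin> coords l" using that Entry by auto
      then have "gram_vec (coords l) (differential H u) (\<lambda>c. if c = b then 1 else 0) = 0"
        by (auto simp: gram_vec_def vec_eq_iff sum.delta[OF finite_coords] if_distrib cong: if_cong)
      then have "det (\<chi> i j. if j = k then gram_vec (coords l) (differential H u) (\<lambda>c. if c = b then 1 else 0) $ i
         else gram (coords l) (differential H u) $ i $ j) = 0" for k
        by (intro det_zero_column(1)[of k]) (simp add: column_def vec_eq_iff)
      then have "pr u (\<lambda>c. if c = b then 1 else 0) a = 0"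
        unfolding pr[OF that(1)] by (simp only: mult_zero_left sum.neutral_const)
      then show ?thesis using Entry by (simp add: emb)
    qed
  next
    case (Pull d)
    then have "d \<notin> coords l" using that(2) by auto
    then show ?thesis using g that(1) Pull unfolding smooth_level_def emb by simp
  qed (simp add: emb)
  moreover have "level (grassmann_image H u) = Suc l" if "u \<in> U" for u
    using that g by (auto simp: smooth_level_def grassmann_image_def)
  ultimately show ?thesis by (auto simp: smooth_level_def)
qed

lemma smooth_level_iter:
  fixes q :: "real^'p::finite \<Rightarrow> real^'m::finite"
  assumes U: "open U" and q: "Ck_on n q U" and inj: "\<And>u. u \<in> U \<Longrightarrow> inj (frechet_derivative q (at u))"
    and ln: "l \<le> n"
  shows "smooth_level (n - l) l (grassmann_iter l q) U \<and>
     (l < n \<longrightarrow> (\<forall>u\<in>U. inj (differential (grassmann_iter l q) u)))"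
  using ln
proof (induction l)
  case 0
  have comp: "Ck_on n (\<lambda>x. f x $ i) U" if "Ck_on n f U" for f :: "real^'p \<Rightarrow> real^'m" and n i
    using that
  proof (induction n arbitrary: f)
    case 0
    then show ?case by (simp add: continuous_on_component)
  next
    case (Suc n)
    show ?case
    proof (rule Ck_on_SucI[OF U])
      show "((\<lambda>x. f x $ i) has_derivative (\<lambda>v. frechet_derivative f (at x) v $ i)) (at x)" if "x \<in> U" for x
        by (rule bounded_linear.has_derivative[OF bounded_linear_vec_nth Ck_on_SucE(1)[OF Suc.prems that]])
      show "Ck_on n (\<lambda>x. frechet_derivative f (at x) v $ i) U" for v
        by (rule Suc.IH[OF Ck_on_SucE(2)[OF Suc.prems]])
    qed
  qed
  have e: "embed (Point x) c = 0" if "c \<notin> coords 0" for x :: "real^'m" and c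
    using that by (cases c) auto
  have g: "smooth_level n 0 (grassmann_iter 0 q) U"
    unfolding smooth_level_def
  proof (intro conjI ballI allI impI)
    fix c show "Ck_on n (\<lambda>u. embed (grassmann_iter 0 q u) c) U"
      using comp[OF q] by (cases c) (simp_all add: Ck_on_const del: Ck_on.simps)
  next
    fix u :: "real^'p" and c :: "'m coord" assume "c \<notin> coords 0"
    from e[OF this] show "embed (grassmann_iter 0 q u) c = 0" by simp
  qed simp
  have i: "inj (differential (grassmann_iter 0 q) u)" if "0 < n" "u \<in> U" for u
  proof (rule injI)
    obtain n' where n: "n = Suc n'" using gr0_implies_Suc[OF \<open>0 < n\<close>] by blast
    have qd: "(q has_derivative frechet_derivative q (at u)) (at u)"
      using Ck_on_SucE(1)[OF q[unfolded n] that(2)] .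
    have d: "differential (grassmann_iter 0 q) u v (Base i) = frechet_derivative q (at u) v $ i" for v i
    proof -
      have "(\<lambda>v. frechet_derivative q (at u) v $ i) = frechet_derivative (\<lambda>u. q u $ i) (at u)"
        by (rule frechet_derivative_at[OF bounded_linear.has_derivative[OF bounded_linear_vec_nth[of i] qd]])
      from fun_cong[OF this, of v] show ?thesis unfolding differential_def grassmann_iter.simps embed.simps by (rule sym)
    qed
    fix v w assume eq: "differential (grassmann_iter 0 q) u v = differential (grassmann_iter 0 q) u w"
    have "frechet_derivative q (at u) v $ i = frechet_derivative q (at u) w $ i" for i
      using fun_cong[OF eq, of "Base i"] unfolding d .
    then have "frechet_derivative q (at u) v = frechet_derivative q (at u) w"
      unfolding vec_eq_iff by (rule allI)
    then show "v = w" by (rule injD[OF inj[OF that(2)]])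
  qed
  show ?case unfolding diff_zero by (intro conjI g impI ballI i)
next
  case (Suc l)
  let ?H = "grassmann_iter l q"
  have s: "n - l = Suc (n - Suc l)" using Suc.prems by simp
  have ln: "l \<le> n" "l < n" using Suc.prems by simp_all
  have g: "smooth_level (Suc (n - Suc l)) l ?H U" and i: "\<And>u. u \<in> U \<Longrightarrow> inj (differential ?H u)"
    using Suc.IH[OF ln(1)] ln(2) unfolding s by blast+
  have g': "smooth_level (n - Suc l) (Suc l) (grassmann_image ?H) U"
    using smooth_level_step[OF U g i] by simp
  have "inj (differential (grassmann_image ?H) u)" if "u \<in> U" for u
  proof -
    have "differential (grassmann_image ?H) u v (Pull c) = differential ?H u v c" for v c
      by (simp add: differential_def grassmann_image_def)
    then have "differential ?H u v = differential ?H u w"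
      if "differential (grassmann_image ?H) u v = differential (grassmann_image ?H) u w" for v w
      using fun_cong[OF that, of "Pull _"] by (intro ext) simp
    then show ?thesis using injD[OF i[OF that]] by (intro injI) blast
  qed
  with g' show ?case by simp
qed

lemma grassmann_iter_in_tower:
  fixes q :: "real^'p::finite \<Rightarrow> real^'m::finite"
  assumes U: "open U" and q: "Ck_on n q U" and inj: "\<And>u. u \<in> U \<Longrightarrow> inj (frechet_derivative q (at u))"
  shows "l \<le> n \<Longrightarrow> u \<in> U \<Longrightarrow> grassmann_iter l q u \<in> tower TYPE('p) l"
proof (induction l arbitrary: u)
  case 0
  show ?case by simp
next
  case (Suc l)
  let ?H = "grassmann_iter l q"
  let ?T = "tower TYPE('p) l :: 'm gpoint set"
  have s: "n - l = Suc (n - Suc l)" using Suc.prems by simp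
  have ln: "l \<le> n" "l < n" using Suc.prems(1) by simp_all
  note gi = smooth_level_iter[OF U q inj ln(1), unfolded s]
  have g: "smooth_level (Suc (n - Suc l)) l ?H U" and i: "inj (differential ?H u)"
    using gi ln(2) Suc.prems(2) by blast+
  have lin: "linear (\<lambda>v. differential ?H u v c)" for c
    by (rule differential_props(1)[OF U Suc.prems(2) g])
  have T: "?H y \<in> ?T" if "y \<in> U" for y by (rule Suc.IH[OF ln(1) that])
  have "is_plane TYPE('p) (range (differential ?H u))"
    unfolding is_plane_def by (intro exI[of _ "differential ?H u"] conjI allI lin i refl)
  moreover have "differential ?H u v \<in> tangent_space ?T (?H u)" for v
  proof -
    define \<gamma> where "\<gamma> t = (if u + t *\<^sub>R v \<in> U then ?H (u + t *\<^sub>R v) else ?H u)" for t :: real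
    define S where "S = (\<lambda>t. u + t *\<^sub>R v) -` U"
    have S: "open S" unfolding S_def
      by (rule open_vimage[OF U]) (intro continuous_intros)
    have S0: "0 \<in> S" unfolding S_def using Suc.prems(2) by simp
    have "((\<lambda>t. embed (\<gamma> t) c) has_real_derivative differential ?H u v c) (at 0)" for c
    proof -
      have d: "((\<lambda>u. embed (?H u) c) has_derivative (\<lambda>v. differential ?H u v c)) (at (u + 0 *\<^sub>R v))"
        using differential_props(3)[OF U Suc.prems(2) g, of c] by simp
      have a: "((\<lambda>t. u + t *\<^sub>R v) has_derivative (\<lambda>t. t *\<^sub>R v)) (at 0)"
        by (auto intro!: derivative_eq_intros)
      have "((\<lambda>t. embed (?H (u + t *\<^sub>R v)) c) has_derivative (\<lambda>t. differential ?H u (t *\<^sub>R v) c)) (at 0)"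
        by (rule has_derivative_compose[OF a d])
      moreover have "(\<lambda>t. differential ?H u (t *\<^sub>R v) c) = (*) (differential ?H u v c)"
        by (rule ext) (simp add: linear_cmul[OF lin])
      ultimately have "((\<lambda>t. embed (?H (u + t *\<^sub>R v)) c) has_real_derivative differential ?H u v c) (at 0)"
        unfolding has_field_derivative_def by simp
      then show ?thesis
        by (rule has_field_derivative_transform_within_open[OF _ S S0]) (simp add: \<gamma>_def S_def)
    qed
    moreover have "\<gamma> t \<in> ?T" for t using T Suc.prems(2) by (simp add: \<gamma>_def)
    moreover have "\<gamma> 0 = ?H u" by (simp add: \<gamma>_def)
    ultimately show ?thesis unfolding tangent_space_def by blast
  qed
  ultimately show ?case
    using T[OF Suc.prems(2)] unfolding grassmann_iter.simps grassmann_image_def tower.simps by blast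
qed

lemma Ck_on_subset: "Ck_on n h V \<Longrightarrow> W \<subseteq> V \<Longrightarrow> Ck_on n h W"
proof (induction n arbitrary: h)
  case 0
  then show ?case by (simp add: continuous_on_subset)
next
  case (Suc n)
  then show ?case unfolding Ck_on.simps(2) by blast
qed

lemma Ck_on_local:
  assumes "\<And>x. x \<in> U \<Longrightarrow> \<exists>V. open V \<and> x \<in> V \<and> Ck_on n h V"
  shows "Ck_on n h U"
  using assms
proof (induction n arbitrary: h)
  case 0
  show ?case unfolding Ck_on.simps(1)
  proof (rule continuous_at_imp_continuous_on, rule ballI)
    fix x assume "x \<in> U"
    then obtain V where "open V" "x \<in> V" "continuous_on V h" using 0[of x] by auto
    then show "isCont h x" by (simp add: continuous_on_eq_continuous_at)
  qed
next
  case (Suc n)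
  have "Ck_on n (\<lambda>x. frechet_derivative h (at x) v) U" for v
  proof (rule Suc.IH)
    fix x assume "x \<in> U"
    then show "\<exists>V. open V \<and> x \<in> V \<and> Ck_on n (\<lambda>x. frechet_derivative h (at x) v) V"
      using Suc.prems[of x] unfolding Ck_on.simps(2) by blast
  qed
  moreover have "h differentiable (at x)" if "x \<in> U" for x
    using Suc.prems[OF that] unfolding Ck_on.simps(2) by blast
  ultimately show ?case unfolding Ck_on.simps(2) by blast
qed

lemma Cr_on_open:
  assumes "open U" "Cr_on r q U" "enat n \<le> r"
  shows "Ck_on n q U"
proof (rule Ck_on_local)
  fix x assume x: "x \<in> U"
  then obtain V g where V: "open V" "x \<in> V" "Ck_on n g V" "\<forall>y\<in>U \<inter> V. g y = q y"
    using assms(2,3) unfolding Cr_on_def by blast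
  have o: "open (U \<inter> V)" using V assms(1) by blast
  have "Ck_on n q (U \<inter> V)"
  proof (rule Ck_on_cong[OF o])
    show "Ck_on n g (U \<inter> V)" using Ck_on_subset[OF V(3)] by simp
  qed (use V(4) in simp)
  then show "\<exists>V. open V \<and> x \<in> V \<and> Ck_on n q V" using o V(2) x by blast
qed

lemma parametrization_immersion:
  assumes p: "Cr_parametrization r q U u0 M x0" and r: "1 \<le> r" and u: "u \<in> U"
  shows "inj (frechet_derivative q (at u))"
proof -
  have U: "open U" and C: "Cr_on r q U" "Cr_on r (inv_into U q) (q ` U)" and I: "inj_on q U"
    using p by (auto simp: Cr_parametrization_def Cr_diffeomorphism_def bij_betw_def)
  have r1: "enat (Suc 0) \<le> r" using r by (simp add: one_enat_def)
  have "q u \<in> q ` U" using u by blast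
  then obtain V g where V: "open V" "q u \<in> V" "Ck_on (Suc 0) g V" "\<forall>y\<in>q ` U \<inter> V. g y = inv_into U q y"
    using C(2) r1 unfolding Cr_on_def by blast
  have q1: "Ck_on (Suc 0) q U" by (rule Cr_on_open[OF U C(1) r1])
  have cq: "continuous_on U q" using Ck_on_SucD[OF q1] by simp
  note qd = Ck_on_SucE(1)[OF q1 u]
  note gd = Ck_on_SucE(1)[OF V(3,2)]
  have o: "open (U \<inter> q -` V)" by (rule continuous_open_preimage[OF cq U V(1)])
  have uo: "u \<in> U \<inter> q -` V" using V(2) u by simp
  have h: "((\<lambda>x. g (q x)) has_derivative (\<lambda>v. frechet_derivative g (at (q u)) (frechet_derivative q (at u) v))) (at u)"
    by (rule has_derivative_compose[OF qd gd])
  have "((\<lambda>x. x) has_derivative (\<lambda>v. frechet_derivative g (at (q u)) (frechet_derivative q (at u) v))) (at u)"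
    by (rule has_derivative_transform_within_open[OF h o uo]) (use V(4) I in simp)
  then have "(\<lambda>v. frechet_derivative g (at (q u)) (frechet_derivative q (at u) v)) = (\<lambda>v. v)"
    by (rule has_derivative_unique[OF _ has_derivative_ident])
  then have e: "frechet_derivative g (at (q u)) (frechet_derivative q (at u) v) = v" for v
    by (rule fun_cong)
  show ?thesis by (rule inj_on_inverseI[of _ "frechet_derivative g (at (q u))"]) (rule e)
qed

lemma parametrization_in_tower:
  fixes q :: "real^'p::finite \<Rightarrow> real^'m::finite"
  assumes p: "Cr_parametrization r q U u0 M x0" and r: "1 \<le> r" "enat l \<le> r" and u: "u \<in> U"
  shows "grassmann_iter l q u \<in> tower TYPE('p) l"
proof -
  have U: "open U" and C: "Cr_on r q U"
    using p by (simp_all add: Cr_parametrization_def Cr_diffeomorphism_def)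
  show ?thesis
    by (rule grassmann_iter_in_tower[OF U Cr_on_open[OF U C r(2)] parametrization_immersion[OF p r(1)] order.refl u])
qed

end

theory Submission
  imports Defs
begin

text \<open>
  Call two functions in contact of order \<open>n\<close> at \<open>x\<close> if their difference is \<open>o(|y - x|\<^sup>n)\<close>. For functions of
  class \<open>C\<^sup>n\<close> this means that their derivatives up to order \<open>n\<close> agree at \<open>x\<close>, so differentiation
  lowers the order of contact by one, and conversely functions with equal values at \<open>x\<close> gain one
  order over their first derivatives (\<open>contact_deriv\<close>, \<open>contact_integral\<close>). Tangency of order \<open>k\<close> is
  contact of order \<open>k\<close> between the coordinates of two parametrizations.
  
  Tangency implies equality of the Grassmann images of the same two parametrizations: the
  coordinates of \<open>grassmann_image H\<close> are those of \<open>H\<close> and the entries of the projection onto the range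
  of its differential, which are rational functions of the first derivatives. Each Grassmann image
  thus costs one order of contact (\<open>level_contact_grassmann_image\<close>). Hence the \<open>l\<close>-th images are in
  contact of order \<open>k - l\<close>; below level \<open>k\<close> this order is at least one, so the tangent planes at
  \<open>u0\<close> coincide.
  
  For the converse an arbitrary pair of parametrizations will not do, because a plane does not
  remember the linear map that parametrizes it. Both manifolds have the same tangent plane at \<open>x0\<close>;
  let \<open>\<pi>\<close> be linear and injective on it. By the inverse function theorem both manifolds are, near
  \<open>x0\<close>, images of maps \<open>s\<close>, \<open>s'\<close> with \<open>\<pi> (s y) = y = \<pi> (s' y)\<close>, that is, graphs over the same
  coordinate plane (\<open>common_graph_parametrizations\<close>). Reparametrization moves the iterated Grassmann
  images only along the source, so they still coincide at the centre. For such graphs the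
  differential of every iterated image has the same constant left inverse, built from \<open>\<pi>\<close>, and a
  linear injection with a prescribed left inverse is determined by its range. Quantitatively,
  contact of order \<open>n\<close> of the projections onto the ranges gives contact of order \<open>n\<close> of the
  differentials (\<open>injection_difference\<close>), hence contact of order \<open>n + 1\<close> one level lower
  (\<open>level_contact_of_grassmann_image\<close>). At level \<open>k - 1\<close> equality of the tangent planes gives contact
  of order \<open>1\<close>; descending to level \<open>0\<close> gives contact of order \<open>k\<close>.
\<close>

section \<open>Flat functions and their derivatives\<close>

(* The defining equation would replace smoothness hypotheses by statements about all directional
   derivatives; the introduction and elimination rules for the successor step are used instead. *)
declare Ck_on.simps(2) [simp del]

lemma mean_value_segment:
  fixes h :: "'a::euclidean_space \<Rightarrow> real"
  assumes "\<And>s. 0 \<le> s \<Longrightarrow> s \<le> 1 \<Longrightarrow> (h has_derivative h' (x + s *\<^sub>R w)) (at (x + s *\<^sub>R w))"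
  obtains s where "0 \<le> s" "s \<le> 1" "h (x + w) - h x = h' (x + s *\<^sub>R w) w"
proof -
  have d: "((\<lambda>s. h (x + s *\<^sub>R w)) has_derivative (\<lambda>r. h' (x + s *\<^sub>R w) (r *\<^sub>R w))) (at s within {0..1})"
    if "0 \<le> s" "s \<le> 1" for s
  proof -
    have "((\<lambda>s. x + s *\<^sub>R w) has_derivative (\<lambda>r. r *\<^sub>R w)) (at s)"
      by (auto intro!: derivative_eq_intros)
    from has_derivative_compose[OF this assms[OF that]] show ?thesis
      by (rule has_derivative_at_withinI)
  qed
  obtain s where "s \<in> {0<..<1}"
    "h (x + 1 *\<^sub>R w) - h (x + 0 *\<^sub>R w) = h' (x + s *\<^sub>R w) ((1 - 0) *\<^sub>R w)"
    using mvt_simple[OF zero_less_one d] by blast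
  then show thesis by (intro that[of s]) auto
qed

text \<open>
  That a flat function has vanishing derivatives is proved with iterated differences. In contrast to
  Taylor expansion along lines, which only sees \<open>v, v, \<dots>, v\<close>, they reach the mixed derivatives
  directly, without symmetry of the derivatives and without polarization.
\<close>

primrec iter_deriv :: "'a::euclidean_space list \<Rightarrow> ('a \<Rightarrow> real) \<Rightarrow> 'a \<Rightarrow> real" where
  "iter_deriv [] h = h"
| "iter_deriv (v # vs) h = iter_deriv vs (\<lambda>x. frechet_derivative h (at x) v)"

primrec iter_diff :: "real \<Rightarrow> 'a::euclidean_space list \<Rightarrow> ('a \<Rightarrow> real) \<Rightarrow> 'a \<Rightarrow> real" where
  "iter_diff t [] h = h"
| "iter_diff t (v # vs) h = (\<lambda>x. iter_diff t vs h (x + t *\<^sub>R v) - iter_diff t vs h x)"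

abbreviation total_norm :: "'a::euclidean_space list \<Rightarrow> real" where
  "total_norm vs \<equiv> (\<Sum>v\<leftarrow>vs. norm v)"

lemma total_norm_nonneg: "0 \<le> total_norm vs"
  by (rule sum_list_nonneg) auto

lemma Ck_on_iter_deriv:
  "Ck_on n h S \<Longrightarrow> length vs \<le> n \<Longrightarrow> Ck_on (n - length vs) (iter_deriv vs h) S"
proof (induction vs arbitrary: n h)
  case (Cons v vs)
  then obtain m where n: "n = Suc m" by (cases n) auto
  show ?case
    using Cons.IH[OF Ck_on_SucE(2)[OF Cons.prems(1)[unfolded n], of v]] Cons.prems(2) n by simp
qed simp

lemma iter_diff_has_derivative:
  assumes "0 \<le> t" "\<And>y. norm (y - x) \<le> t * total_norm vs \<Longrightarrow> (h has_derivative h' y) (at y)"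
  shows "(iter_diff t vs h has_derivative (\<lambda>w. iter_diff t vs (\<lambda>y. h' y w) x)) (at x)"
  using assms(2)
proof (induction vs arbitrary: x)
  case (Cons v vs)
  have n: "norm (t *\<^sub>R v) = t * norm v" using assms(1) by simp
  have a: "(iter_diff t vs h has_derivative (\<lambda>w. iter_diff t vs (\<lambda>y. h' y w) x)) (at x)"
  proof (rule Cons.IH)
    fix y assume "norm (y - x) \<le> t * total_norm vs"
    moreover have "0 \<le> t * norm v" using assms(1) by simp
    ultimately show "(h has_derivative h' y) (at y)"
      by (intro Cons.prems) (simp add: algebra_simps)
  qed
  have b: "(iter_diff t vs h has_derivative (\<lambda>w. iter_diff t vs (\<lambda>y. h' y w) (x + t *\<^sub>R v)))
      (at (x + t *\<^sub>R v))"
  proof (rule Cons.IH)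
    fix y assume y: "norm (y - (x + t *\<^sub>R v)) \<le> t * total_norm vs"
    have "norm (y - x) \<le> norm (y - (x + t *\<^sub>R v)) + norm (t *\<^sub>R v)"
      using norm_triangle_ineq[of "y - (x + t *\<^sub>R v)" "t *\<^sub>R v"] by simp
    with y n have "norm (y - x) \<le> t * total_norm (v # vs)" by (simp only: list.map sum_list.Cons distrib_left)
    then show "(h has_derivative h' y) (at y)" by (rule Cons.prems)
  qed
  have "((\<lambda>x. x + t *\<^sub>R v) has_derivative (\<lambda>w. w)) (at x)"
    by (auto intro!: derivative_eq_intros)
  from has_derivative_diff[OF has_derivative_compose[OF this b] a] show ?case by simp
qed simp

text \<open>
  Taking differences commutes with differentiation, so that the mean value theorem, applied to the
  outermost difference, exchanges one difference for the factor \<open>t\<close> and one derivative.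
\<close>

lemma iter_diff_mean_value:
  fixes h :: "'a::euclidean_space \<Rightarrow> real"
  assumes "0 \<le> t" "Ck_on (length vs) h S" "\<And>y. norm (y - x) \<le> t * total_norm vs \<Longrightarrow> y \<in> S"
  shows "\<exists>\<xi>. norm (\<xi> - x) \<le> t * total_norm vs \<and> iter_diff t vs h x = t ^ length vs * iter_deriv vs h \<xi>"
  using assms(2,3)
proof (induction vs arbitrary: h x)
  case Nil
  then show ?case by (intro exI[of _ x]) simp
next
  case (Cons v vs)
  let ?D = "\<lambda>y. frechet_derivative h (at y)"
  have C: "Ck_on (Suc (length vs)) h S" using Cons.prems(1) by simp
  have tri: "norm (y - x) \<le> t * total_norm (v # vs)"
    if "norm (y - (x + s *\<^sub>R t *\<^sub>R v)) \<le> t * total_norm vs" "0 \<le> s" "s \<le> 1" for y s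
  proof -
    have "norm (y - x) \<le> norm (y - (x + s *\<^sub>R t *\<^sub>R v)) + norm (s *\<^sub>R t *\<^sub>R v)"
      using norm_triangle_ineq[of "y - (x + s *\<^sub>R t *\<^sub>R v)" "s *\<^sub>R t *\<^sub>R v"] by simp
    also have "norm (s *\<^sub>R t *\<^sub>R v) \<le> t * norm v"
      using assms(1) that(2,3) mult_right_mono[of s 1 "t * norm v"] by simp
    finally show ?thesis using that(1) by (simp add: algebra_simps)
  qed
  have d: "(iter_diff t vs h has_derivative (\<lambda>w. iter_diff t vs (\<lambda>y. ?D y w) (x + s *\<^sub>R t *\<^sub>R v)))
     (at (x + s *\<^sub>R t *\<^sub>R v))" if "0 \<le> s" "s \<le> 1" for s
    by (rule iter_diff_has_derivative[OF assms(1)])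
       (rule Ck_on_SucE(1)[OF C Cons.prems(2)[OF tri[OF _ that]]])
  obtain s where s: "0 \<le> s" "s \<le> 1" and
    e: "iter_diff t vs h (x + t *\<^sub>R v) - iter_diff t vs h x
      = iter_diff t vs (\<lambda>y. ?D y (t *\<^sub>R v)) (x + s *\<^sub>R t *\<^sub>R v)"
    by (rule mean_value_segment[where h = "iter_diff t vs h" and x = x and w = "t *\<^sub>R v", OF d])
  let ?x = "x + s *\<^sub>R t *\<^sub>R v"
  have e': "iter_diff t vs (\<lambda>y. ?D y (t *\<^sub>R v)) ?x = t * iter_diff t vs (\<lambda>y. ?D y v) ?x"
    using linear_cmul[OF has_derivative_linear[OF d[OF s]], of t v] by simp
  obtain \<xi> where \<xi>: "norm (\<xi> - ?x) \<le> t * total_norm vs"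
    "iter_diff t vs (\<lambda>y. ?D y v) ?x = t ^ length vs * iter_deriv vs (\<lambda>y. ?D y v) \<xi>"
    using Cons.IH[OF Ck_on_SucE(2)[OF C]] Cons.prems(2)[OF tri[OF _ s]] by blast
  show ?case
    using tri[OF \<xi>(1) s] \<xi>(2) e e' by (intro exI[of _ \<xi>]) simp
qed

lemma iter_diff_bound:
  assumes "0 \<le> t" "\<And>y. norm (y - x) \<le> t * total_norm vs \<Longrightarrow> \<bar>h y\<bar> \<le> e"
  shows "\<bar>iter_diff t vs h x\<bar> \<le> 2 ^ length vs * e"
  using assms(2)
proof (induction vs arbitrary: x)
  case (Cons v vs)
  have n: "norm (t *\<^sub>R v) = t * norm v" and p: "0 \<le> t * norm v" using assms(1) by simp_all
  have "\<bar>iter_diff t vs h x\<bar> \<le> 2 ^ length vs * e"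
    using p by (intro Cons.IH Cons.prems) (simp add: algebra_simps)
  moreover have "\<bar>iter_diff t vs h (x + t *\<^sub>R v)\<bar> \<le> 2 ^ length vs * e"
  proof (rule Cons.IH)
    fix y assume y: "norm (y - (x + t *\<^sub>R v)) \<le> t * total_norm vs"
    have "norm (y - x) \<le> norm (y - (x + t *\<^sub>R v)) + norm (t *\<^sub>R v)"
      using norm_triangle_ineq[of "y - (x + t *\<^sub>R v)" "t *\<^sub>R v"] by simp
    with y n have "norm (y - x) \<le> t * total_norm (v # vs)" by (simp only: list.map sum_list.Cons distrib_left)
    then show "\<bar>h y\<bar> \<le> e" by (rule Cons.prems)
  qed
  ultimately show ?case by simp
qed simp

text \<open>
  The \<open>n\<close>-th difference with steps of size \<open>t\<close> combines values of \<open>h\<close> at distance \<open>O(t)\<close> from \<open>x\<close>, so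
  it is \<open>o(t\<^sup>n)\<close>. It also equals \<open>t\<^sup>n\<close> times the iterated derivative at a point near \<open>x\<close>, and that
  derivative is continuous.
\<close>

lemma flat_imp_iter_deriv_zero:
  fixes h :: "'a::euclidean_space \<Rightarrow> real"
  assumes S: "open S" "x \<in> S" and C: "Ck_on (length vs) h S"
    and o: "h \<in> o[nhds x](\<lambda>y. norm (y - x) ^ length vs)"
  shows "iter_deriv vs h x = 0"
proof (rule ccontr)
  define n where "n = length vs"
  define L where "L = total_norm vs + 1"
  define a where "a = \<bar>iter_deriv vs h x\<bar>"
  assume "iter_deriv vs h x \<noteq> 0"
  then have a: "0 < a" by (simp add: a_def)
  have L: "0 < L" "total_norm vs \<le> L" using total_norm_nonneg[of vs] by (simp_all add: L_def)
  \<comment> \<open>The constant is small enough that the bound \<open>2 ^ n * c * (t * L) ^ n\<close> for the difference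
      equals \<open>t ^ n * (a / 4)\<close>, against a lower bound of \<open>t ^ n * (a / 2)\<close> from continuity.\<close>
  define c where "c = a / (4 * (2 * L) ^ n)"
  have c: "0 < c" using a L by (simp add: c_def)
  have "continuous_on S (iter_deriv vs h)" using Ck_on_iter_deriv[OF C, of vs] by simp
  then have "isCont (iter_deriv vs h) x" using S continuous_on_eq_continuous_at by blast
  then have "((\<lambda>y. \<bar>iter_deriv vs h y\<bar>) \<longlongrightarrow> a) (nhds x)"
    unfolding a_def by (intro tendsto_rabs) (simp add: isCont_def tendsto_at_iff_tendsto_nhds)
  then have "\<forall>\<^sub>F y in nhds x. a / 2 < \<bar>iter_deriv vs h y\<bar>"
    using a by (intro order_tendstoD) auto
  moreover have "\<forall>\<^sub>F y in nhds x. y \<in> S" using S by (rule eventually_nhds_in_open)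
  moreover have "\<forall>\<^sub>F y in nhds x. norm (h y) \<le> c * norm (norm (y - x) ^ n)"
    using landau_o.smallD[OF o c] by (simp add: n_def)
  ultimately have "\<forall>\<^sub>F y in nhds x. a / 2 < \<bar>iter_deriv vs h y\<bar> \<and> y \<in> S \<and> \<bar>h y\<bar> \<le> c * norm (y - x) ^ n"
    by eventually_elim simp
  then obtain d where d: "0 < d" and
    near: "\<And>y. norm (y - x) < d \<Longrightarrow> a / 2 < \<bar>iter_deriv vs h y\<bar> \<and> y \<in> S \<and> \<bar>h y\<bar> \<le> c * norm (y - x) ^ n"
    unfolding eventually_nhds_metric dist_norm by blast
  define t where "t = d / (2 * L)"
  have t: "0 < t" using d L by (simp add: t_def)
  have tL: "t * L = d / 2" using L by (simp add: t_def)
  have le: "norm (y - x) \<le> t * L" if "norm (y - x) \<le> t * total_norm vs" for y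
    using that mult_left_mono[OF L(2), of t] t by linarith
  have lt: "norm (y - x) < d" if "norm (y - x) \<le> t * total_norm vs" for y
    using le[OF that] tL d by linarith
  obtain \<xi> where \<xi>: "norm (\<xi> - x) \<le> t * total_norm vs"
    "iter_diff t vs h x = t ^ n * iter_deriv vs h \<xi>"
    using iter_diff_mean_value[of t vs h S x] t C near lt unfolding n_def by fastforce
  have "\<bar>h y\<bar> \<le> c * (t * L) ^ n" if "norm (y - x) \<le> t * total_norm vs" for y
  proof -
    have "\<bar>h y\<bar> \<le> c * norm (y - x) ^ n" using near lt[OF that] by blast
    also have "\<dots> \<le> c * (t * L) ^ n"
      using c le[OF that] by (intro mult_left_mono power_mono) auto
    finally show ?thesis .
  qed
  then have "\<bar>iter_diff t vs h x\<bar> \<le> 2 ^ length vs * (c * (t * L) ^ n)"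
    using t by (intro iter_diff_bound) auto
  also have "\<dots> = t ^ n * (a / 4)"
    using L by (simp add: c_def n_def power_mult_distrib)
  finally have "t ^ n * \<bar>iter_deriv vs h \<xi>\<bar> \<le> t ^ n * (a / 4)"
    using \<xi>(2) t by (simp add: abs_mult)
  then have "\<bar>iter_deriv vs h \<xi>\<bar> \<le> a / 4" using t by simp
  with near[OF lt[OF \<xi>(1)]] a show False by linarith
qed

text \<open>
  The mean value theorem on the segment from \<open>x\<close> to \<open>y\<close> bounds \<open>h y\<close> by \<open>|y - x|\<close> times the size of
  the derivative on that segment. The filter \<open>nhds x\<close>, and not \<open>at x\<close>, is used in all these statements:
  then flatness of any order includes the vanishing of the function at \<open>x\<close> itself.
\<close>

lemma flat_integral:
  fixes h :: "'a::euclidean_space \<Rightarrow> real"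
  assumes S: "open S" "x \<in> S" and hx: "h x = 0"
    and d: "\<And>y. y \<in> S \<Longrightarrow> (h has_derivative h' y) (at y)"
    and o: "\<And>v. (\<lambda>y. h' y v) \<in> o[nhds x](\<lambda>y. norm (y - x) ^ n)"
  shows "h \<in> o[nhds x](\<lambda>y. norm (y - x) ^ Suc n)"
proof (rule landau_o.smallI)
  fix c :: real assume c: "0 < c"
  define e where "e = c / DIM('a)"
  have e: "0 < e" using c by (simp add: e_def)
  have "\<forall>\<^sub>F y in nhds x. \<bar>h' y b\<bar> \<le> e * norm (y - x) ^ n" for b
    using landau_o.smallD[OF o[of b] e] by simp
  then have "\<forall>\<^sub>F y in nhds x. \<forall>b\<in>Basis. \<bar>h' y b\<bar> \<le> e * norm (y - x) ^ n"
    by (intro eventually_ball_finite) auto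
  moreover have "\<forall>\<^sub>F y in nhds x. y \<in> S" using S by (rule eventually_nhds_in_open)
  ultimately have "\<forall>\<^sub>F y in nhds x. y \<in> S \<and> (\<forall>b\<in>Basis. \<bar>h' y b\<bar> \<le> e * norm (y - x) ^ n)"
    by eventually_elim simp
  then obtain r where r: "0 < r" and
    near: "\<And>y. norm (y - x) < r \<Longrightarrow> y \<in> S \<and> (\<forall>b\<in>Basis. \<bar>h' y b\<bar> \<le> e * norm (y - x) ^ n)"
    unfolding eventually_nhds_metric dist_norm by blast
  have "norm (h y) \<le> c * norm (norm (y - x) ^ Suc n)" if y: "norm (y - x) < r" for y
  proof -
    have seg: "norm (x + s *\<^sub>R (y - x) - x) \<le> norm (y - x)" if "0 \<le> s" "s \<le> 1" for s
      using that by (simp add: mult_left_le_one_le)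
    have "(h has_derivative h' (x + s *\<^sub>R (y - x))) (at (x + s *\<^sub>R (y - x)))" if "0 \<le> s" "s \<le> 1" for s
      using seg[OF that] y near by (intro d) fastforce
    then obtain s where s: "0 \<le> s" "s \<le> 1" "h (x + (y - x)) - h x = h' (x + s *\<^sub>R (y - x)) (y - x)"
      by (rule mean_value_segment) blast+
    define z where "z = x + s *\<^sub>R (y - x)"
    have z: "norm (z - x) \<le> norm (y - x)" unfolding z_def by (rule seg[OF s(1,2)])
    have zn: "z \<in> S" "\<And>b. b \<in> Basis \<Longrightarrow> \<bar>h' z b\<bar> \<le> e * norm (z - x) ^ n"
      using near[of z] z y by auto
    have "h' z (y - x) = h' z (\<Sum>b\<in>Basis. ((y - x) \<bullet> b) *\<^sub>R b)" by (simp only: euclidean_representation)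
    also have "\<dots> = (\<Sum>b\<in>Basis. ((y - x) \<bullet> b) * h' z b)"
      using has_derivative_linear[OF d[OF zn(1)]] by (simp add: linear_sum linear_cmul)
    finally have "\<bar>h' z (y - x)\<bar> \<le> (\<Sum>b\<in>Basis. \<bar>((y - x) \<bullet> b) * h' z b\<bar>)" by (simp add: sum_abs)
    also have "\<dots> \<le> (\<Sum>b\<in>(Basis::'a set). norm (y - x) * (e * norm (y - x) ^ n))"
    proof (rule sum_mono)
      fix b :: 'a assume b: "b \<in> Basis"
      have "\<bar>h' z b\<bar> \<le> e * norm (y - x) ^ n"
        using zn(2)[OF b] e z power_mono[OF z norm_ge_zero, of n]
        by (meson less_imp_le mult_left_mono order_trans)
      then show "\<bar>((y - x) \<bullet> b) * h' z b\<bar> \<le> norm (y - x) * (e * norm (y - x) ^ n)"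
        unfolding abs_mult using Basis_le_norm[OF b] by (intro mult_mono) auto
    qed
    also have "\<dots> = c * norm (y - x) ^ Suc n" by (simp add: e_def)
    finally show ?thesis using s(3) hx by (simp add: z_def)
  qed
  then show "\<forall>\<^sub>F y in nhds x. norm (h y) \<le> c * norm (norm (y - x) ^ Suc n)"
    using r unfolding eventually_nhds_metric dist_norm by blast
qed

lemma iter_deriv_zero_imp_flat:
  fixes h :: "'a::euclidean_space \<Rightarrow> real"
  assumes S: "open S" "x \<in> S" and "Ck_on n h S" "\<And>vs. length vs \<le> n \<Longrightarrow> iter_deriv vs h x = 0"
  shows "h \<in> o[nhds x](\<lambda>y. norm (y - x) ^ n)"
  using assms(3,4)
proof (induction n arbitrary: h)
  case 0
  have "isCont h x" using 0 S continuous_on_eq_continuous_at by auto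
  moreover have "h x = 0" using 0(2)[of "[]"] by simp
  ultimately have "(h \<longlongrightarrow> 0) (nhds x)" using tendsto_at_iff_tendsto_nhds[of h x] by (simp add: isCont_def)
  then show ?case by (intro smalloI_tendsto) auto
next
  case (Suc n)
  show ?case
  proof (rule flat_integral[OF S])
    show "h x = 0" using Suc.prems(2)[of "[]"] by simp
    show "(h has_derivative frechet_derivative h (at y)) (at y)" if "y \<in> S" for y
      by (rule Ck_on_SucE(1)[OF Suc.prems(1) that])
    show "(\<lambda>y. frechet_derivative h (at y) v) \<in> o[nhds x](\<lambda>y. norm (y - x) ^ n)" for v
      using Suc.prems(2)[of "v # _"] by (intro Suc.IH Ck_on_SucE(2)[OF Suc.prems(1)]) auto
  qed
qed

lemma flat_mono:
  assumes "h \<in> o[nhds x](\<lambda>y. norm (y - x) ^ n)" "m \<le> n"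
  shows "h \<in> o[nhds x](\<lambda>y. norm (y - x) ^ m)"
proof -
  have "\<forall>\<^sub>F y in nhds x. norm (y - x) \<le> 1"
    unfolding eventually_nhds_metric dist_norm by (intro exI[of _ 1]) auto
  then have "\<forall>\<^sub>F y in nhds x. norm (norm (y - x) ^ n) \<le> 1 * norm (norm (y - x) ^ m)"
    by eventually_elim (simp add: power_decreasing[OF assms(2)])
  then have "(\<lambda>y. norm (y - x) ^ n) \<in> O[nhds x](\<lambda>y. norm (y - x) ^ m)" by (rule landau_o.bigI[rotated]) simp
  with assms(1) show ?thesis by (rule landau_o.small_big_trans)
qed

text \<open>
  Flatness of order \<open>n\<close> depends only on the iterated derivatives at \<open>x\<close>, and those of a directional
  derivative are among those of the function.
\<close>

lemma flat_deriv:
  fixes h :: "'a::euclidean_space \<Rightarrow> real"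
  assumes S: "open S" "x \<in> S" and C: "Ck_on (Suc n) h S"
    and o: "h \<in> o[nhds x](\<lambda>y. norm (y - x) ^ Suc n)"
  shows "(\<lambda>y. frechet_derivative h (at y) v) \<in> o[nhds x](\<lambda>y. norm (y - x) ^ n)"
proof (rule iter_deriv_zero_imp_flat[OF S Ck_on_SucE(2)[OF C]])
  fix vs :: "'a list" assume "length vs \<le> n"
  then have l: "length (v # vs) \<le> Suc n" by simp
  show "iter_deriv vs (\<lambda>y. frechet_derivative h (at y) v) x = 0"
    using flat_imp_iter_deriv_zero[OF S Ck_on_le[OF C l] flat_mono[OF o l]] by simp
qed

section \<open>Contact of functions\<close>

text \<open>
  Continuity at \<open>x\<close> is part of the notion because it makes both functions locally bounded, which is
  what products and quotients need.
\<close>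

definition contact ::
    "nat \<Rightarrow> 'a::euclidean_space \<Rightarrow> ('a \<Rightarrow> real) \<Rightarrow> ('a \<Rightarrow> real) \<Rightarrow> bool" where
  "contact n x f g \<longleftrightarrow> isCont f x \<and> isCont g x \<and>
     (\<lambda>y. f y - g y) \<in> o[nhds x](\<lambda>y. norm (y - x) ^ n)"

lemma isCont_bigo_one: "isCont f x \<Longrightarrow> f \<in> O[nhds x](\<lambda>_. 1::real)" for f :: "'a::euclidean_space \<Rightarrow> real"
  using tendsto_at_iff_tendsto_nhds[of f x]
  by (intro bigoI_tendsto[of _ _ "f x"]) (auto simp: isCont_def)

lemma flat_mult_bounded:
  fixes f h :: "'a::euclidean_space \<Rightarrow> real"
  assumes "isCont f x" "h \<in> o[nhds x](p)"
  shows "(\<lambda>y. f y * h y) \<in> o[nhds x](p)"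
  using landau_o.big_small_mult[OF isCont_bigo_one[OF assms(1)] assms(2)] by simp

lemma contact_refl: "isCont f x \<Longrightarrow> contact n x f f"
  by (simp add: contact_def)

lemma contact_0_iff: "contact 0 x f g \<longleftrightarrow> isCont f x \<and> isCont g x \<and> f x = g x"
proof -
  have "(\<lambda>y. f y - g y) \<in> o[nhds x](\<lambda>y. 1) \<longleftrightarrow> f x = g x" if "isCont f x" "isCont g x"
  proof -
    have t: "((\<lambda>y. f y - g y) \<longlongrightarrow> f x - g x) (nhds x)"
      using that tendsto_at_iff_tendsto_nhds[of f x] tendsto_at_iff_tendsto_nhds[of g x]
      by (intro tendsto_diff) (auto simp: isCont_def)
    show ?thesis
    proof
      assume "(\<lambda>y. f y - g y) \<in> o[nhds x](\<lambda>y. 1)"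
      from smalloD_tendsto[OF this] have "((\<lambda>y. f y - g y) \<longlongrightarrow> 0) (nhds x)" by simp
      from tendsto_unique[OF _ t this] show "f x = g x" by (simp add: nhds_neq_bot)
    next
      assume "f x = g x"
      with t show "(\<lambda>y. f y - g y) \<in> o[nhds x](\<lambda>y. 1)" by (intro smalloI_tendsto) auto
    qed
  qed
  then show ?thesis by (auto simp: contact_def)
qed

lemma contact_mono: "contact n x f g \<Longrightarrow> m \<le> n \<Longrightarrow> contact m x f g"
  unfolding contact_def using flat_mono by blast

lemma contact_imp_eq: "contact n x f g \<Longrightarrow> f x = g x"
  using contact_mono[of n x f g 0] by (simp add: contact_0_iff)

lemma contact_cong:
  assumes "open S" "x \<in> S" "\<And>y. y \<in> S \<Longrightarrow> f y = f' y" "\<And>y. y \<in> S \<Longrightarrow> g y = g' y" "contact n x f g"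
  shows "contact n x f' g'"
proof -
  have ev: "\<forall>\<^sub>F y in nhds x. y \<in> S" using assms(1,2) by (rule eventually_nhds_in_open)
  have "isCont f x \<longleftrightarrow> isCont f' x" "isCont g x \<longleftrightarrow> isCont g' x"
    by (rule isCont_cong, rule eventually_mono[OF ev], simp add: assms(3,4))+
  moreover have "(\<lambda>y. f y - g y) \<in> o[nhds x](\<lambda>y. norm (y - x) ^ n) \<longleftrightarrow>
      (\<lambda>y. f' y - g' y) \<in> o[nhds x](\<lambda>y. norm (y - x) ^ n)"
    by (intro landau_o.small.in_cong eventually_mono[OF ev]) (simp add: assms(3,4))
  ultimately show ?thesis using assms(5) by (simp add: contact_def)
qed

lemma contact_add: "contact n x f g \<Longrightarrow> contact n x f' g' \<Longrightarrow> contact n x (\<lambda>y. f y + f' y) (\<lambda>y. g y + g' y)"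
  unfolding contact_def using sum_in_smallo(1)[of "\<lambda>y. f y - g y" "nhds x" _ "\<lambda>y. f' y - g' y"]
  by (auto simp: algebra_simps)

lemma contact_mult:
  assumes "contact n x f g" "contact n x f' g'"
  shows "contact n x (\<lambda>y. f y * f' y) (\<lambda>y. g y * g' y)"
proof -
  have "(\<lambda>y. f y * (f' y - g' y) + g' y * (f y - g y)) \<in> o[nhds x](\<lambda>y. norm (y - x) ^ n)"
    using assms unfolding contact_def by (intro sum_in_smallo(1) flat_mult_bounded) auto
  then have "(\<lambda>y. f y * f' y - g y * g' y) \<in> o[nhds x](\<lambda>y. norm (y - x) ^ n)"
    by (simp add: algebra_simps)
  with assms show ?thesis by (auto simp: contact_def)
qed

text \<open>
  \<open>1 / f - 1 / g = - (f - g) / (f g)\<close>, and the factor \<open>1 / (f g)\<close> is bounded near \<open>x\<close>.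
\<close>

lemma contact_inverse:
  assumes "contact n x f g" "f x \<noteq> 0"
  shows "contact n x (\<lambda>y. inverse (f y)) (\<lambda>y. inverse (g y))"
proof -
  have g: "g x \<noteq> 0" using assms contact_imp_eq by metis
  have c: "isCont f x" "isCont g x" using assms by (auto simp: contact_def)
  have i: "isCont (\<lambda>y. inverse (f y)) x" "isCont (\<lambda>y. inverse (g y)) x"
    using c g assms(2) by (auto intro: continuous_intros)
  have ne: "\<forall>\<^sub>F y in nhds x. h y \<noteq> 0" if "isCont h x" "h x \<noteq> 0" for h :: "'a \<Rightarrow> real"
    using that tendsto_at_iff_tendsto_nhds[of h x] by (intro tendsto_imp_eventually_ne) (auto simp: isCont_def)
  from ne[OF c(1) assms(2)] ne[OF c(2) g] have "\<forall>\<^sub>F y in nhds x. (- (inverse (f y) * inverse (g y))) * (f y - g y) = inverse (f y) - inverse (g y)"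
    by eventually_elim (simp add: field_simps)
  from landau_o.small.in_cong[OF this]
  have "(\<lambda>y. inverse (f y) - inverse (g y)) \<in> o[nhds x](\<lambda>y. norm (y - x) ^ n)"
    if "(\<lambda>y. (- (inverse (f y) * inverse (g y))) * (f y - g y)) \<in> o[nhds x](\<lambda>y. norm (y - x) ^ n)"
    using that by (rule iffD1)
  moreover have "(\<lambda>y. (- (inverse (f y) * inverse (g y))) * (f y - g y)) \<in> o[nhds x](\<lambda>y. norm (y - x) ^ n)"
    using assms(1) i by (intro flat_mult_bounded) (auto simp: contact_def intro!: continuous_intros)
  ultimately have "(\<lambda>y. inverse (f y) - inverse (g y)) \<in> o[nhds x](\<lambda>y. norm (y - x) ^ n)" by simp
  with i show ?thesis by (simp add: contact_def)
qed

lemma contact_sum: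
  "(\<And>i. i \<in> I \<Longrightarrow> contact n x (f i) (g i)) \<Longrightarrow> contact n x (\<lambda>y. \<Sum>i\<in>I. f i y) (\<lambda>y. \<Sum>i\<in>I. g i y)"
  by (induction I rule: infinite_finite_induct) (auto intro: contact_refl contact_add)

lemma contact_prod:
  "(\<And>i. i \<in> I \<Longrightarrow> contact n x (f i) (g i)) \<Longrightarrow> contact n x (\<lambda>y. \<Prod>i\<in>I. f i y) (\<lambda>y. \<Prod>i\<in>I. g i y)"
  by (induction I rule: infinite_finite_induct) (auto intro: contact_refl contact_mult)

lemma contact_det:
  fixes A B :: "'a::euclidean_space \<Rightarrow> real^'n^'n"
  assumes "\<And>i j. contact n x (\<lambda>y. A y $ i $ j) (\<lambda>y. B y $ i $ j)"
  shows "contact n x (\<lambda>y. det (A y)) (\<lambda>y. det (B y))"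
  unfolding det_def by (intro contact_sum contact_mult contact_prod contact_refl assms continuous_const)

lemma Ck_on_imp_isCont:
  assumes "open S" "x \<in> S" "Ck_on n h S"
  shows "isCont h x"
  using Ck_on_le[OF assms(3), of 0] assms(1,2) continuous_on_eq_continuous_at by auto

lemma contact_deriv:
  fixes f g :: "'a::euclidean_space \<Rightarrow> real"
  assumes S: "open S" "x \<in> S" and f: "Ck_on (Suc n) f S" and g: "Ck_on (Suc n) g S"
    and c: "contact (Suc n) x f g"
  shows "contact n x (\<lambda>y. frechet_derivative f (at y) v) (\<lambda>y. frechet_derivative g (at y) v)"
proof -
  have d: "((\<lambda>y. f y - g y) has_derivative
      (\<lambda>v. frechet_derivative f (at y) v - frechet_derivative g (at y) v)) (at y)" if "y \<in> S" for y
    by (intro has_derivative_diff Ck_on_SucE(1)[OF f] Ck_on_SucE(1)[OF g] that)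
  have "Ck_on (Suc n) (\<lambda>y. f y + (-1) * g y) S"
    by (intro Ck_on_add Ck_on_mult Ck_on_const S f g)
  then have C: "Ck_on (Suc n) (\<lambda>y. f y - g y) S" by simp
  have "(\<lambda>y. frechet_derivative (\<lambda>y. f y - g y) (at y) v) \<in> o[nhds x](\<lambda>y. norm (y - x) ^ n)"
    using c by (intro flat_deriv[OF S C]) (simp add: contact_def)
  moreover have "\<forall>\<^sub>F y in nhds x. frechet_derivative (\<lambda>y. f y - g y) (at y) v =
      frechet_derivative f (at y) v - frechet_derivative g (at y) v"
    using eventually_nhds_in_open[OF S]
    by (rule eventually_mono) (rule fun_cong[OF frechet_derivative_at[OF d, symmetric]])
  from landau_o.small.in_cong[OF this] calculation have "(\<lambda>y. frechet_derivative f (at y) v - frechet_derivative g (at y) v)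
      \<in> o[nhds x](\<lambda>y. norm (y - x) ^ n)"
    by (rule iffD1)
  then show ?thesis
    using Ck_on_imp_isCont[OF S Ck_on_SucE(2)[OF f]] Ck_on_imp_isCont[OF S Ck_on_SucE(2)[OF g]]
    by (simp add: contact_def)
qed

text \<open>
  Together with \<open>contact_deriv\<close> this is the rule by which orders of contact change along the tower.
\<close>

lemma contact_integral:
  fixes f g :: "'a::euclidean_space \<Rightarrow> real"
  assumes S: "open S" "x \<in> S" and e: "f x = g x"
    and f: "\<And>y. y \<in> S \<Longrightarrow> (f has_derivative f' y) (at y)"
    and g: "\<And>y. y \<in> S \<Longrightarrow> (g has_derivative g' y) (at y)"
    and c: "\<And>v. contact n x (\<lambda>y. f' y v) (\<lambda>y. g' y v)"
  shows "contact (Suc n) x f g"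
proof -
  have "(\<lambda>y. f y - g y) \<in> o[nhds x](\<lambda>y. norm (y - x) ^ Suc n)"
  proof (rule flat_integral[OF S])
    show "((\<lambda>y. f y - g y) has_derivative (\<lambda>v. f' y v - g' y v)) (at y)" if "y \<in> S" for y
      by (intro has_derivative_diff f g that)
  qed (use e c in \<open>simp_all add: contact_def\<close>)
  then show ?thesis
    using has_derivative_continuous[OF f] has_derivative_continuous[OF g] S by (simp add: contact_def)
qed

section \<open>Contact and the Grassmann image\<close>

text \<open>
  Cramer's solution of the normal equations: the coefficients, in the parametrization \<open>L\<close>, of the
  orthogonal projection of \<open>x\<close> onto the range of \<open>L\<close>.
\<close>

definition proj_coeff :: "'c set \<Rightarrow> (real^'p \<Rightarrow> 'c \<Rightarrow> real) \<Rightarrow> ('c \<Rightarrow> real) \<Rightarrow> real^'p" where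
  "proj_coeff I L x =
     (\<chi> k. det (\<chi> i j. if j = k then gram_vec I L x $ i else gram I L $ i $ j) / det (gram I L))"

abbreviation unit_coord :: "'c \<Rightarrow> 'c \<Rightarrow> real" where
  "unit_coord b \<equiv> (\<lambda>c. if c = b then 1 else 0)"

lemma orth_proj_eq_proj_coeff:
  fixes L :: "real^'p \<Rightarrow> 'c \<Rightarrow> real"
  assumes "finite I" "\<And>c. linear (\<lambda>v. L v c)" "inj L" "\<And>v c. c \<notin> I \<Longrightarrow> L v c = 0"
  shows "orth_proj I (range L) x = L (proj_coeff I L x)"
  unfolding proj_coeff_def by (rule orth_proj_range(2)[of I L, OF assms])

text \<open>
  The projection of a vector depends linearly on it, and a vector of the range is its own projection;
  only the projections of the unit vectors are recorded in the coordinates of the tower. The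
  coefficients of both sides solve the same normal equations.
\<close>

lemma orth_proj_fixes_range:
  fixes L :: "real^'p \<Rightarrow> 'c \<Rightarrow> real"
  assumes I: "finite I" and lin: "\<And>c. linear (\<lambda>v. L v c)" and inj: "inj L"
    and vanish: "\<And>v c. c \<notin> I \<Longrightarrow> L v c = 0"
  shows "(\<Sum>b\<in>I. orth_proj I (range L) (unit_coord b) a * L v b) = L v a"
proof -
  note P = orth_proj_eq_proj_coeff[of I L, OF I lin inj vanish]
  note d = orth_proj_range(1)[of I L, OF I lin inj vanish]
  define t where "t b = proj_coeff I L (unit_coord b)" for b
  have c: "gram I L *v y = gram_vec I L x \<longleftrightarrow> y = proj_coeff I L x" for y x
    unfolding proj_coeff_def by (rule cramer[OF d])
  have g: "gram_vec I L (unit_coord b) $ i = L (axis i 1) b" if "b \<in> I" for b i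
    using that I by (simp add: gram_vec_def if_distrib sum.delta cong: if_cong)
  have "gram I L *v (\<Sum>b\<in>I. L v b *\<^sub>R t b) = (\<Sum>b\<in>I. L v b *\<^sub>R (gram I L *v t b))"
    by (simp add: linear_sum[OF matrix_vector_mul_linear] linear_cmul[OF matrix_vector_mul_linear])
  also have "\<dots> = (\<Sum>b\<in>I. L v b *\<^sub>R gram_vec I L (unit_coord b))"
    by (simp only: t_def c[of "proj_coeff I L _", THEN iffD2, OF refl])
  also have "\<dots> = gram_vec I L (L v)"
    by (simp add: vec_eq_iff g gram_vec_def[of I L "L v"] mult.commute cong: sum.cong)
  finally have "(\<Sum>b\<in>I. L v b *\<^sub>R t b) = v"
    using c[of v "L v"] c[of "\<Sum>b\<in>I. L v b *\<^sub>R t b" "L v"] gram_apply[of L I v, OF lin] by simp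
  then have "L v a = L (\<Sum>b\<in>I. L v b *\<^sub>R t b) a" by simp
  also have "\<dots> = (\<Sum>b\<in>I. L v b * L (t b) a)"
    by (simp add: linear_sum[OF lin] linear_cmul[OF lin])
  finally show ?thesis by (simp add: P t_def mult.commute)
qed

text \<open>
  Two injections with a common left inverse \<open>\<beta>\<close> are compared through the projections \<open>P\<close>, \<open>P'\<close> onto their
  ranges. As \<open>P\<close> fixes \<open>L v\<close> and \<open>P'\<close> fixes \<open>L' v\<close>, the difference of \<open>L v\<close> and \<open>L' v\<close> is
  \<open>R = (P - P') (L' v)\<close> plus \<open>P (L v - L' v)\<close>. The last vector lies in the range of \<open>L\<close>, so it is
  \<open>L z\<close> for some \<open>z\<close>, and applying \<open>\<beta>\<close>, which annihilates \<open>L v - L' v\<close>, gives \<open>z = - \<beta> R\<close>. The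
  formula bounds the difference of the injections by that of the projections.
  
  In the tower the left inverse sees only the coordinates of the base point, whence the family \<open>e\<close>
  of coordinates on which it depends.
\<close>

lemma injection_difference:
  fixes L L' :: "real^'p \<Rightarrow> 'c \<Rightarrow> real" and e :: "'i::finite \<Rightarrow> 'c"
  assumes I: "finite I"
    and L: "\<And>c. linear (\<lambda>v. L v c)" "inj L" "\<And>v c. c \<notin> I \<Longrightarrow> L v c = 0"
    and L': "\<And>c. linear (\<lambda>v. L' v c)" "inj L'" "\<And>v c. c \<notin> I \<Longrightarrow> L' v c = 0"
    and inv: "\<And>k v. (\<Sum>i\<in>UNIV. \<beta> k i * L v (e i)) = v $ k" "\<And>k v. (\<Sum>i\<in>UNIV. \<beta> k i * L' v (e i)) = v $ k"
  defines "R \<equiv> \<lambda>v a. \<Sum>b\<in>I. (orth_proj I (range L) (unit_coord b) a - orth_proj I (range L') (unit_coord b) a) * L' v b"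
  shows "L v a - L' v a = R v a - (\<Sum>k\<in>UNIV. (\<Sum>i\<in>UNIV. \<beta> k i * R v (e i)) * L (axis k 1) a)"
proof -
  define z where "z = (\<Sum>b\<in>I. (L v b - L' v b) *\<^sub>R proj_coeff I L (unit_coord b))"
  note P = orth_proj_eq_proj_coeff[of I L, OF I L]
  have "L z a = (\<Sum>b\<in>I. orth_proj I (range L) (unit_coord b) a * (L v b - L' v b))" for a
    unfolding z_def by (simp add: linear_sum[OF L(1)] linear_cmul[OF L(1)] P mult.commute)
  then have Lz: "L z a = L v a - L' v a - R v a" for a
    using orth_proj_fixes_range[of I L, OF I L, of a v] orth_proj_fixes_range[of I L', OF I L', of a v]
    unfolding R_def by (simp add: left_diff_distrib right_diff_distrib sum_subtractf)
  have "z $ k = - (\<Sum>i\<in>UNIV. \<beta> k i * R v (e i))" for k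
  proof -
    have "z $ k = (\<Sum>i\<in>UNIV. \<beta> k i * L z (e i))" by (simp add: inv)
    also have "\<dots> = v $ k - v $ k - (\<Sum>i\<in>UNIV. \<beta> k i * R v (e i))"
      unfolding Lz inv(1)[of k v, symmetric] by (subst (2) inv(1), subst inv(2)[symmetric])
        (simp add: right_diff_distrib sum_subtractf)
    finally show ?thesis by simp
  qed
  then have "L z a = - (\<Sum>k\<in>UNIV. (\<Sum>i\<in>UNIV. \<beta> k i * R v (e i)) * L (axis k 1) a)"
    by (subst linear_axis_expand[OF L(1)]) (simp add: sum_negf)
  with Lz[of a] show ?thesis by simp
qed

definition level_contact ::
    "nat \<Rightarrow> real^'p \<Rightarrow> (real^'p::finite \<Rightarrow> 'm::finite gpoint) \<Rightarrow> (real^'p \<Rightarrow> 'm gpoint) \<Rightarrow> bool" where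
  "level_contact n x H H' \<longleftrightarrow> (\<forall>c. contact n x (\<lambda>u. embed (H u) c) (\<lambda>u. embed (H' u) c))"

text \<open>
  The level of differentiability is shifted by one because such a map is always about to be
  differentiated: \<open>n\<close> is the class of its differential.
\<close>

definition immersed_level :: "nat \<Rightarrow> nat \<Rightarrow> (real^'p::finite \<Rightarrow> 'm::finite gpoint) \<Rightarrow> (real^'p) set \<Rightarrow> bool" where
  "immersed_level n l H U \<longleftrightarrow> open U \<and> smooth_level (Suc n) l H U \<and> (\<forall>u\<in>U. inj (differential H u))"

lemma immersed_levelD:
  assumes "immersed_level n l H U"
  shows "open U" "Ck_on (Suc n) (\<lambda>u. embed (H u) c) U" "Ck_on n (\<lambda>u. differential H u v c) U"
    and "u \<in> U \<Longrightarrow> level (H u) = l" "u \<in> U \<Longrightarrow> linear (\<lambda>v. differential H u v c)"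
    and "u \<in> U \<Longrightarrow> inj (differential H u)" "u \<in> U \<Longrightarrow> c \<notin> coords l \<Longrightarrow> differential H u v c = 0"
    and "u \<in> U \<Longrightarrow> ((\<lambda>u. embed (H u) c) has_derivative (\<lambda>v. differential H u v c)) (at u)"
  using assms differential_props[of U u n l H] Ck_on_SucE(2)[of n "\<lambda>u. embed (H u) c" U v]
  by (auto simp: immersed_level_def smooth_level_def differential_def)

lemma embed_grassmann_image:
  "embed (grassmann_image H u) (Base i) = 0"
  "embed (grassmann_image H u) (Pull c) = embed (H u) c"
  "embed (grassmann_image H u) (Entry a b) =
     orth_proj (coords (level (H u))) (range (differential H u)) (unit_coord b) a"
  by (simp_all add: grassmann_image_def)

lemma level_contact_differential:
  assumes H: "immersed_level n l H U" and H': "immersed_level n l H' U" and x: "x \<in> U"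
    and c: "level_contact (Suc n) x H H'"
  shows "contact n x (\<lambda>u. differential H u v c) (\<lambda>u. differential H' u v c)"
  unfolding differential_def
  using c immersed_levelD(1,2)[OF H] immersed_levelD(2)[OF H'] x
  by (intro contact_deriv[where S = U]) (simp_all add: level_contact_def)

text \<open>
  The new coordinates are obtained from the first derivatives by sums, products, determinants and one
  division by the Gram determinant, which does not vanish for an immersion; contact survives
  all of these.
\<close>

lemma level_contact_grassmann_image:
  fixes H H' :: "real^'p::finite \<Rightarrow> 'm::finite gpoint"
  assumes H: "immersed_level n l H U" and H': "immersed_level n l H' U" and x: "x \<in> U"
    and c: "level_contact (Suc n) x H H'"
  shows "level_contact n x (grassmann_image H) (grassmann_image H')"
  unfolding level_contact_def
proof
  fix c
  let ?I = "coords l"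
  note D = level_contact_differential[OF H H' x c]
  have gram: "contact n x (\<lambda>u. gram ?I (differential H u) $ i $ j) (\<lambda>u. gram ?I (differential H' u) $ i $ j)" for i j
    unfolding gram_def vec_lambda_beta by (intro contact_sum contact_mult D)
  have gram_vec: "contact n x (\<lambda>u. gram_vec ?I (differential H u) y $ i) (\<lambda>u. gram_vec ?I (differential H' u) y $ i)" for i y
    unfolding gram_vec_def vec_lambda_beta by (intro contact_sum contact_mult D contact_refl continuous_const)
  have M: "contact n x
      (\<lambda>u. (\<chi> i j. if j = k then gram_vec ?I (differential H u) y $ i else gram ?I (differential H u) $ i $ j) $ i $ j)
      (\<lambda>u. (\<chi> i j. if j = k then gram_vec ?I (differential H' u) y $ i else gram ?I (differential H' u) $ i $ j) $ i $ j)"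
    for k y i j
    using gram gram_vec by (cases "j = k") simp_all
  have nz: "det (gram ?I (differential H x)) \<noteq> 0"
    by (rule orth_proj_range(1)[OF finite_coords immersed_levelD(5,6,7)[OF H x]])
  have coeff: "contact n x (\<lambda>u. proj_coeff ?I (differential H u) y $ k) (\<lambda>u. proj_coeff ?I (differential H' u) y $ k)" for y k
    unfolding proj_coeff_def vec_lambda_beta divide_inverse
    by (intro contact_mult contact_inverse contact_det M gram nz)
  have entry: "embed (grassmann_image F u) (Entry a b) =
      (\<Sum>k\<in>UNIV. proj_coeff ?I (differential F u) (unit_coord b) $ k * differential F u (axis k 1) a)"
    if F: "immersed_level n l F U" and u: "u \<in> U" for F :: "real^'p \<Rightarrow> 'm gpoint" and u a b
    unfolding embed_grassmann_image immersed_levelD(4)[OF F u]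
    by (rule trans[OF fun_cong[OF orth_proj_eq_proj_coeff[OF finite_coords immersed_levelD(5,6,7)[OF F u]]]
          linear_axis_expand[OF immersed_levelD(5)[OF F u]]])
  show "contact n x (\<lambda>u. embed (grassmann_image H u) c) (\<lambda>u. embed (grassmann_image H' u) c)"
  proof (cases c)
    case (Entry a b)
    have "contact n x
       (\<lambda>u. \<Sum>k\<in>UNIV. proj_coeff ?I (differential H u) (unit_coord b) $ k * differential H u (axis k 1) a)
       (\<lambda>u. \<Sum>k\<in>UNIV. proj_coeff ?I (differential H' u) (unit_coord b) $ k * differential H' u (axis k 1) a)"
      by (intro contact_sum contact_mult coeff D)
    from contact_cong[OF immersed_levelD(1)[OF H] x entry[OF H, symmetric] entry[OF H', symmetric] this]
    show ?thesis unfolding Entry .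
  qed (use c contact_mono[of "Suc n" x _ _ n] in \<open>auto simp: embed_grassmann_image level_contact_def intro: contact_refl\<close>)
qed

text \<open>
  The explicit formula of \<open>injection_difference\<close> turns contact
  of the projections into contact of the differentials, which is then integrated. As the left inverse is
  constant in \<open>u\<close>, all terms of the formula are products of flat functions with continuous ones.
\<close>

lemma level_contact_of_grassmann_image:
  fixes H H' :: "real^'p::finite \<Rightarrow> 'm::finite gpoint" and e :: "'i::finite \<Rightarrow> 'm coord"
  assumes H: "immersed_level n l H U" and H': "immersed_level n l H' U" and x: "x \<in> U"
    and c: "level_contact n x (grassmann_image H) (grassmann_image H')" and eq: "H x = H' x"
    and inv: "\<And>u k v. u \<in> U \<Longrightarrow> (\<Sum>i\<in>UNIV. \<beta> k i * differential H u v (e i)) = v $ k"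
    and inv': "\<And>u k v. u \<in> U \<Longrightarrow> (\<Sum>i\<in>UNIV. \<beta> k i * differential H' u v (e i)) = v $ k"
  shows "level_contact (Suc n) x H H'"
  unfolding level_contact_def
proof (rule allI, rule contact_integral)
  let ?I = "coords l"
  let ?o = "o[nhds x](\<lambda>y. norm (y - x) ^ n)"
  define P P' where "P u = (\<lambda>a b. embed (grassmann_image H u) (Entry a b))"
    and "P' u = (\<lambda>a b. embed (grassmann_image H' u) (Entry a b))" for u
  define R where "R v a u = (\<Sum>b\<in>?I. (P u a b - P' u a b) * differential H' u v b)" for v a u
  have cont: "isCont (\<lambda>u. differential H u v c) x" "isCont (\<lambda>u. differential H' u v c) x" for v c
    using Ck_on_imp_isCont[OF immersed_levelD(1)[OF H] x] immersed_levelD(3)[OF H] immersed_levelD(3)[OF H'] by blast+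
  have "(\<lambda>u. differential H' u v b * (P u a b - P' u a b)) \<in> ?o" for v a b
    using c unfolding level_contact_def contact_def P_def P'_def by (intro flat_mult_bounded cont) blast
  then have R: "R v a \<in> ?o" for v a
    unfolding R_def by (intro big_sum_in_smallo) (simp add: mult.commute)
  have key: "differential H u v a - differential H' u v a =
      R v a u - (\<Sum>k\<in>UNIV. (\<Sum>i\<in>UNIV. \<beta> k i * R v (e i) u) * differential H u (axis k 1) a)"
    if u: "u \<in> U" for u v a
    unfolding R_def P_def P'_def embed_grassmann_image immersed_levelD(4)[OF H u] immersed_levelD(4)[OF H' u]
    by (rule injection_difference[OF finite_coords immersed_levelD(5,6,7)[OF H u] immersed_levelD(5,6,7)[OF H' u]
          inv[OF u] inv'[OF u]])
  fix c
  show "open U" by (rule immersed_levelD(1)[OF H])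
  show "x \<in> U" by (rule x)
  show "embed (H x) c = embed (H' x) c" using eq by simp
  show "((\<lambda>u. embed (H u) c) has_derivative (\<lambda>v. differential H u v c)) (at u)" if "u \<in> U" for u
    by (rule immersed_levelD(8)[OF H that])
  show "((\<lambda>u. embed (H' u) c) has_derivative (\<lambda>v. differential H' u v c)) (at u)" if "u \<in> U" for u
    by (rule immersed_levelD(8)[OF H' that])
  fix v
  have "(\<lambda>u. \<beta> k i * R v (e i) u) \<in> ?o" for k i
    by (rule flat_mult_bounded[OF continuous_const R])
  then have "(\<lambda>u. \<Sum>i\<in>UNIV. \<beta> k i * R v (e i) u) \<in> ?o" for k
    by (rule big_sum_in_smallo)
  then have "(\<lambda>u. differential H u (axis k 1) c * (\<Sum>i\<in>UNIV. \<beta> k i * R v (e i) u)) \<in> ?o" for k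
    by (rule flat_mult_bounded[OF cont(1)])
  then have "(\<lambda>u. R v c u - (\<Sum>k\<in>UNIV. (\<Sum>i\<in>UNIV. \<beta> k i * R v (e i) u) * differential H u (axis k 1) c)) \<in> ?o"
    by (intro sum_in_smallo(2) R big_sum_in_smallo) (simp add: mult.commute)
  moreover have "\<forall>\<^sub>F u in nhds x. R v c u - (\<Sum>k\<in>UNIV. (\<Sum>i\<in>UNIV. \<beta> k i * R v (e i) u) * differential H u (axis k 1) c)
       = differential H u v c - differential H' u v c"
    using eventually_nhds_in_open[OF immersed_levelD(1)[OF H] x] by (rule eventually_mono) (rule key[symmetric])
  from landau_o.small.in_cong[OF this] calculation
  have "(\<lambda>u. differential H u v c - differential H' u v c) \<in> ?o" by (rule iffD1)
  then show "contact n x (\<lambda>u. differential H u v c) (\<lambda>u. differential H' u v c)"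
    using cont by (simp add: contact_def)
qed

section \<open>Composition and inversion of smooth maps\<close>

lemma Ck_on_bounded_linear:
  assumes "open S" "bounded_linear L" "Ck_on n f S"
  shows "Ck_on n (\<lambda>x. L (f x)) S"
  using assms(3)
proof (induction n arbitrary: f)
  case 0
  then show ?case by (simp add: bounded_linear.continuous_on[OF assms(2)])
next
  case (Suc n)
  show ?case
    by (rule Ck_on_SucI[OF assms(1) bounded_linear.has_derivative[OF assms(2) Ck_on_SucE(1)[OF Suc.prems]]])
       (assumption | rule Suc.IH Ck_on_SucE(2)[OF Suc.prems])+
qed

lemma Ck_on_ident:
  assumes "open S" shows "Ck_on n (\<lambda>x. x) S"
proof (cases n)
  case (Suc m)
  show ?thesis unfolding Suc by (rule Ck_on_SucI[OF assms has_derivative_ident Ck_on_const])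
qed (simp add: continuous_on_id)

lemma Ck_on_scaleR:
  fixes f :: "'a::euclidean_space \<Rightarrow> real" and g :: "'a \<Rightarrow> 'b::euclidean_space"
  assumes "open S" "Ck_on n f S" "Ck_on n g S"
  shows "Ck_on n (\<lambda>x. f x *\<^sub>R g x) S"
  using assms(2,3)
proof (induction n arbitrary: f g)
  case 0
  then show ?case by (auto intro: continuous_intros)
next
  case (Suc n)
  show ?case
    by (rule Ck_on_SucI[OF assms(1) has_derivative_scaleR])
       (rule Ck_on_SucE[OF Suc.prems(1)] Ck_on_SucE[OF Suc.prems(2)] Ck_on_add[OF assms(1)] Suc.IH
          Ck_on_SucD[OF Suc.prems(1)] Ck_on_SucD[OF Suc.prems(2)] | assumption)+
qed

text \<open>
  In coordinates the derivative of a composite is a finite sum of products of partial derivatives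
  of \<open>f\<close> at \<open>g x\<close> with components of the derivative of \<open>g\<close>, which is what makes the induction go through.
\<close>

lemma Ck_on_compose:
  fixes f :: "'b::euclidean_space \<Rightarrow> 'c::euclidean_space" and g :: "'a::euclidean_space \<Rightarrow> 'b"
  assumes T: "open T" and gT: "g ` T \<subseteq> S" and f: "Ck_on n f S" and g: "Ck_on n g T"
  shows "Ck_on n (\<lambda>x. f (g x)) T"
  using f g
proof (induction n arbitrary: f)
  case 0
  then show ?case using gT by (auto intro: continuous_on_compose2)
next
  case (Suc n)
  let ?f' = "\<lambda>y. frechet_derivative f (at y)" and ?g' = "\<lambda>x. frechet_derivative g (at x)"
  have in_S: "g x \<in> S" if "x \<in> T" for x using gT that by blast
  have d: "((\<lambda>x. f (g x)) has_derivative (\<lambda>v. \<Sum>b\<in>Basis. (?g' x v \<bullet> b) *\<^sub>R ?f' (g x) b)) (at x)" if x: "x \<in> T" for x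
  proof -
    note f' = Ck_on_SucE(1)[OF Suc.prems(1) in_S[OF x]]
    have e: "?f' (g x) w = (\<Sum>b\<in>Basis. (w \<bullet> b) *\<^sub>R ?f' (g x) b)" for w
    proof -
      have "?f' (g x) w = ?f' (g x) (\<Sum>b\<in>Basis. (w \<bullet> b) *\<^sub>R b)" by (simp only: euclidean_representation)
      also have "\<dots> = (\<Sum>b\<in>Basis. (w \<bullet> b) *\<^sub>R ?f' (g x) b)"
        using has_derivative_linear[OF f'] by (simp add: linear_sum linear_cmul)
      finally show ?thesis .
    qed
    show ?thesis
      by (rule has_derivative_eq_rhs[OF has_derivative_compose[OF Ck_on_SucE(1)[OF Suc.prems(2) x] f']])
         (rule ext, rule e)
  qed
  have "Ck_on n (\<lambda>x. ?f' (g x) b) T" for b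
    by (rule Suc.IH[OF Ck_on_SucE(2)[OF Suc.prems(1)] Ck_on_SucD[OF Suc.prems(2)]])
  then have "Ck_on n (\<lambda>x. \<Sum>b\<in>Basis. (?g' x v \<bullet> b) *\<^sub>R ?f' (g x) b) T" for v
    by (intro Ck_on_sum[OF T] Ck_on_scaleR[OF T]
        Ck_on_bounded_linear[OF T bounded_linear_inner_left] Ck_on_SucE(2)[OF Suc.prems(2)])
  with d show ?case by (rule Ck_on_SucI[OF T])
qed

lemma Ck_on_vec:
  fixes f :: "'a::euclidean_space \<Rightarrow> real^'n"
  assumes "open S" "\<And>k. Ck_on n (\<lambda>x. f x $ k) S"
  shows "Ck_on n f S"
proof -
  have "Ck_on n (\<lambda>x. \<Sum>k\<in>UNIV. f x $ k *\<^sub>R (axis k 1 :: real^'n)) S"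
    by (intro Ck_on_sum Ck_on_scaleR Ck_on_const assms)
  then show ?thesis
    by (rule Ck_on_cong[OF assms(1), rotated]) (simp add: basis_expansion flip: scalar_mult_eq_scaleR)
qed

text \<open>
  The derivative of the inverse is the inverse matrix of the derivative of \<open>f\<close>, evaluated at \<open>g y\<close>. By
  Cramer's rule its entries are rational in first derivatives of \<open>f\<close> along \<open>g\<close>, so each degree of
  smoothness of \<open>g\<close> produces the next one.
\<close>

lemma Ck_on_inverse_map:
  fixes f g :: "real^'p \<Rightarrow> real^'p"
  assumes V: "open V" and gV: "g ` V \<subseteq> U" and f: "Ck_on n f U"
    and inj: "\<And>x. x \<in> U \<Longrightarrow> inj (frechet_derivative f (at x))"
    and cont: "continuous_on V g"
    and g': "\<And>y. y \<in> V \<Longrightarrow> (g has_derivative inv (frechet_derivative f (at (g y)))) (at y)"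
  shows "Ck_on n g V"
  using f
proof (induction n)
  case 0
  show ?case using cont by simp
next
  case (Suc n)
  let ?f' = "\<lambda>y. frechet_derivative f (at (g y))"
  have g: "Ck_on n g V" by (rule Suc.IH[OF Ck_on_SucD[OF Suc.prems]])
  define A where "A y = matrix (?f' y)" for y
  have A: "Ck_on n (\<lambda>y. A y $ i $ j) V" for i j
    unfolding A_def matrix_def vec_lambda_beta
    by (intro Ck_on_bounded_linear[OF V bounded_linear_vec_nth] Ck_on_compose[OF V gV _ g] Ck_on_SucE(2)[OF Suc.prems])
  have in_U: "g y \<in> U" if "y \<in> V" for y using gV that by blast
  have lin: "linear (?f' y)" if "y \<in> V" for y
    by (rule has_derivative_linear[OF Ck_on_SucE(1)[OF Suc.prems in_U[OF that]]])
  have det: "det (A y) \<noteq> 0" if "y \<in> V" for y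
    using det_nz_iff_inj[OF lin[OF that]] inj[OF in_U[OF that]] by (simp add: A_def)
  have inv: "inv (?f' y) v = (\<chi> k. det (\<chi> i j. if j = k then v $ i else A y $ i $ j) / det (A y))"
    if "y \<in> V" for y v
  proof -
    have "surj (?f' y)" using linear_injective_imp_surjective[OF lin[OF that] inj[OF in_U[OF that]]] by simp
    then have "A y *v inv (?f' y) v = v"
      using fun_cong[OF matrix_vector_mul(2)[OF lin[OF that]]] by (simp add: A_def surj_f_inv_f)
    then show ?thesis unfolding cramer[OF det[OF that]] .
  qed
  have "Ck_on n (\<lambda>y. det (\<chi> i j. if j = k then v $ i else A y $ i $ j) * inverse (det (A y))) V"
    for k and v :: "real^'p"
  proof -
    have "Ck_on n (\<lambda>y. (\<chi> i j. if j = k then v $ i else A y $ i $ j) $ i $ j) V" for i j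
      using A by (cases "j = k") (simp_all add: Ck_on_const)
    then show ?thesis by (intro Ck_on_mult Ck_on_inverse Ck_on_det V A det)
  qed
  then have "Ck_on n (\<lambda>y. \<chi> k. det (\<chi> i j. if j = k then v $ i else A y $ i $ j) / det (A y)) V" for v :: "real^'p"
    by (intro Ck_on_vec[OF V]) (simp add: divide_inverse)
  then have "Ck_on n (\<lambda>y. inv (?f' y) v) V" for v
    by (rule Ck_on_cong[OF V, rotated]) (simp add: inv)
  from Ck_on_SucI[OF V g' this] show ?case by simp
qed

section \<open>Parametrizations as graphs over a coordinate plane\<close>

lemma Cr_onE:
  assumes "Cr_on r f A" "x \<in> A"
  obtains V g where "open V" "x \<in> V" "\<And>n. enat n \<le> r \<Longrightarrow> Ck_on n g V" "\<And>y. y \<in> A \<Longrightarrow> y \<in> V \<Longrightarrow> g y = f y"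
proof -
  have "\<exists>V g. open V \<and> x \<in> V \<and> (\<forall>n. enat n \<le> r \<longrightarrow> Ck_on n g V) \<and> (\<forall>y\<in>A \<inter> V. g y = f y)"
    using assms(1)[unfolded Cr_on_def] assms(2) by (rule bspec)
  then obtain V g where "open V" "x \<in> V" "\<forall>n. enat n \<le> r \<longrightarrow> Ck_on n g V" "\<forall>y\<in>A \<inter> V. g y = f y"
    by (elim exE conjE)
  then show thesis by (intro that[of V g]) simp_all
qed

lemma Cr_onI:
  assumes "\<And>x. x \<in> A \<Longrightarrow> \<exists>V g. open V \<and> x \<in> V \<and> (\<forall>n. enat n \<le> r \<longrightarrow> Ck_on n g V) \<and> (\<forall>y\<in>A \<inter> V. g y = f y)"
  shows "Cr_on r f A"
  unfolding Cr_on_def by (rule ballI) (rule assms)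

lemma Cr_on_imp_continuous_on:
  assumes "Cr_on r f A" shows "continuous_on A f"
  unfolding continuous_on_eq_continuous_within
proof
  fix x assume x: "x \<in> A"
  then obtain V g where V: "open V" "x \<in> V" and n: "\<And>n. enat n \<le> r \<Longrightarrow> Ck_on n g V"
    and e: "\<And>y. y \<in> A \<Longrightarrow> y \<in> V \<Longrightarrow> g y = f y"
    by (rule Cr_onE[OF assms]) blast
  have "Ck_on 0 g V" using n[of 0] by (simp add: zero_enat_def[symmetric] del: Ck_on.simps)
  then have "continuous_on (A \<inter> V) g" by (auto intro: continuous_on_subset)
  then have "continuous_on (A \<inter> V) f" by (rule continuous_on_eq) (simp add: e)
  moreover have "at x within A = at x within (A \<inter> V)" using V by (intro at_within_nhd[of x V]) auto
  ultimately show "continuous (at x within A) f"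
    using x V by (auto simp: continuous_on_eq_continuous_within)
qed

lemma Cr_on_subset_cong:
  assumes "Cr_on r f A" "B \<subseteq> A" "\<And>x. x \<in> B \<Longrightarrow> f x = g x"
  shows "Cr_on r g B"
proof (rule Cr_onI)
  fix x assume "x \<in> B"
  then have "x \<in> A" using assms(2) by blast
  then obtain V h where V: "open V" "x \<in> V" "\<And>n. enat n \<le> r \<Longrightarrow> Ck_on n h V" "\<And>y. y \<in> A \<Longrightarrow> y \<in> V \<Longrightarrow> h y = f y"
    by (rule Cr_onE[OF assms(1)]) blast
  have "\<forall>y\<in>B \<inter> V. h y = g y"
  proof
    fix y assume "y \<in> B \<inter> V"
    then have "y \<in> A" "y \<in> V" "y \<in> B" using assms(2) by auto
    then show "h y = g y" using V(4) assms(3) by simp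
  qed
  with V(1-3) show "\<exists>V h. open V \<and> x \<in> V \<and> (\<forall>n. enat n \<le> r \<longrightarrow> Ck_on n h V) \<and> (\<forall>y\<in>B \<inter> V. h y = g y)"
    by (intro exI[of _ V] exI[of _ h]) simp
qed

lemma Cr_onI_open:
  assumes "open U" "\<And>n. enat n \<le> r \<Longrightarrow> Ck_on n f U" "A \<subseteq> U"
  shows "Cr_on r f A"
proof (rule Cr_onI)
  fix x assume "x \<in> A"
  with assms show "\<exists>V g. open V \<and> x \<in> V \<and> (\<forall>n. enat n \<le> r \<longrightarrow> Ck_on n g V) \<and> (\<forall>y\<in>A \<inter> V. g y = f y)"
    by (intro exI[of _ U] exI[of _ f]) auto
qed

lemma Cr_parametrizationD:
  assumes "Cr_parametrization r q U u0 M x0"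
  shows "open U" "u0 \<in> U" "q u0 = x0" "inj_on q U" "Cr_on r (inv_into U q) (q ` U)"
    and "openin (top_of_set M) (q ` U)" "enat n \<le> r \<Longrightarrow> Ck_on n q U"
proof -
  show U: "open U" and "u0 \<in> U" "q u0 = x0" "inj_on q U" "Cr_on r (inv_into U q) (q ` U)"
    "openin (top_of_set M) (q ` U)"
    using assms by (simp_all add: Cr_parametrization_def Cr_diffeomorphism_def bij_betw_def)
  have "Cr_on r q U" using assms by (simp add: Cr_parametrization_def Cr_diffeomorphism_def)
  then show "enat n \<le> r \<Longrightarrow> Ck_on n q U" by (rule Cr_on_open[OF U])
qed

lemma Cr_parametrizationI:
  assumes "open U" "u0 \<in> U" "q u0 = x0" "inj_on q U" "Cr_on r q U" "Cr_on r (inv_into U q) (q ` U)"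
    and "openin (top_of_set M) (q ` U)"
  shows "Cr_parametrization r q U u0 M x0"
  using assms by (simp add: Cr_parametrization_def Cr_diffeomorphism_def bij_betw_def)

text \<open>
  A parametrization is a homeomorphism onto its image, which is itself open in \<open>M\<close>.
\<close>

lemma Cr_parametrization_openin:
  assumes p: "Cr_parametrization r q U u0 M x0" and W: "open W" "W \<subseteq> U"
  shows "openin (top_of_set M) (q ` W)"
proof -
  note I = inv_into_f_f[OF Cr_parametrizationD(4)[OF p]]
  have "q ` W = q ` U \<inter> inv_into U q -` W"
  proof
    show "q ` W \<subseteq> q ` U \<inter> inv_into U q -` W" using W(2) I by force
    show "q ` U \<inter> inv_into U q -` W \<subseteq> q ` W" using I by force
  qed
  moreover have "openin (top_of_set (q ` U)) (q ` U \<inter> inv_into U q -` W)"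
    by (rule continuous_openin_preimage_gen[OF Cr_on_imp_continuous_on[OF Cr_parametrizationD(5)[OF p]] W(1)])
  ultimately show ?thesis using openin_trans[OF _ Cr_parametrizationD(6)[OF p]] by simp
qed

lemma Cr_parametrization_subset:
  assumes p: "Cr_parametrization r q U u0 M x0" and W: "open W" "W \<subseteq> U" "u0 \<in> W"
  shows "Cr_parametrization r q W u0 M x0"
proof -
  note D = Cr_parametrizationD[OF p]
  have i: "inj_on q W" using D(4) W(2) by (rule inj_on_subset)
  have "Cr_on r (inv_into W q) (q ` W)"
  proof (rule Cr_on_subset_cong[OF D(5)])
    show "q ` W \<subseteq> q ` U" using W(2) by blast
    fix x assume "x \<in> q ` W"
    then obtain u where u: "u \<in> W" "x = q u" by blast
    with W(2) have "u \<in> U" by blast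
    with u show "inv_into U q x = inv_into W q x"
      by (simp add: inv_into_f_f[OF i] inv_into_f_f[OF D(4)])
  qed
  moreover have "Cr_on r q W"
    by (rule Cr_onI_open[OF D(1) D(7) W(2)])
  ultimately show ?thesis
    by (intro Cr_parametrizationI W(1,3) D(3) i Cr_parametrization_openin[OF p W(1,2)])
qed

text \<open>
  The map \<open>\<pi> \<circ> q\<close> is invertible near \<open>u0\<close>; \<open>\<psi>\<close> is its local inverse. That \<open>q \<circ> \<psi>\<close> is again a
  diffeomorphism onto its image needs no argument about the inverse of \<open>q\<close>: its inverse is the
  restriction of the linear map \<open>\<pi>\<close>.
\<close>

lemma graph_reparametrization:
  fixes q :: "real^'p \<Rightarrow> real^'m" and \<pi> :: "real^'m \<Rightarrow> real^'p"
  assumes p: "Cr_parametrization r q U u0 M x0" and r: "1 \<le> r" and \<pi>: "linear \<pi>"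
    and inj: "inj (\<lambda>v. \<pi> (frechet_derivative q (at u0) v))"
  obtains W \<psi> where "Cr_parametrization r (\<lambda>y. q (\<psi> y)) W (\<pi> x0) M x0" "\<psi> ` W \<subseteq> U" "\<psi> (\<pi> x0) = u0"
    "\<And>y. y \<in> W \<Longrightarrow> \<pi> (q (\<psi> y)) = y"
    "\<And>y. y \<in> W \<Longrightarrow> \<psi> differentiable (at y)" "\<And>y. y \<in> W \<Longrightarrow> surj (frechet_derivative \<psi> (at y))"
proof -
  note D = Cr_parametrizationD[OF p]
  have r1: "enat (Suc 0) \<le> r" using r by (simp add: one_enat_def)
  have bl: "bounded_linear \<pi>" using \<pi> by (simp add: linear_conv_bounded_linear)
  define f where "f = (\<lambda>u. \<pi> (q u))"
  let ?f' = "\<lambda>u. frechet_derivative f (at u)"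
  have f: "Ck_on n f U" if "enat n \<le> r" for n
    unfolding f_def by (rule Ck_on_bounded_linear[OF D(1) bl D(7)[OF that]])
  note f1 = f[OF r1]
  have bl': "bounded_linear (?f' u)" if "u \<in> U" for u
    by (rule has_derivative_bounded_linear[OF Ck_on_SucE(1)[OF f1 that]])
  then have Bl: "blinfun_apply (Blinfun (?f' u)) = ?f' u" if "u \<in> U" for u
    by (rule bounded_linear_Blinfun_apply[OF _ ]) (rule that)
  have "?f' u0 = (\<lambda>v. \<pi> (frechet_derivative q (at u0) v))"
    unfolding f_def
    by (rule frechet_derivative_at[OF bounded_linear.has_derivative[OF bl Ck_on_SucE(1)[OF D(7)[OF r1] D(2)]], symmetric])
  then have "inj (?f' u0)" using inj by simp
  then obtain h where h: "linear h" "h \<circ> ?f' u0 = id"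
    using linear_injective_left_inverse[of "?f' u0"] bl'[OF D(2)] by (auto simp: linear_conv_bounded_linear)
  have hb: "bounded_linear h" using h(1) by (simp add: linear_conv_bounded_linear)
  have invf: "Blinfun h o\<^sub>L Blinfun (?f' u0) = id_blinfun"
    using h(2) by (intro blinfun_eqI) (simp add: bounded_linear_Blinfun_apply[OF hb] Bl[OF D(2)] fun_eq_iff)
  have contf: "continuous_on U (\<lambda>u. Blinfun (?f' u))"
  proof (rule continuous_on_blinfun_componentwise)
    fix i :: "real^'p"
    have "continuous_on U (\<lambda>u. ?f' u i)" using Ck_on_SucE(2)[OF f1, of i] by simp
    then show "continuous_on U (\<lambda>u. blinfun_apply (Blinfun (?f' u)) i)"
      by (rule continuous_on_eq) (simp add: Bl)
  qed
  have df: "(f has_derivative blinfun_apply (Blinfun (?f' u))) (at u)" if "u \<in> U" for u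
    unfolding Bl[OF that] by (rule Ck_on_SucE(1)[OF f1 that])
  obtain U' W \<psi> \<psi>' where U': "open U'" "U' \<subseteq> U" "u0 \<in> U'" and W: "open W" "f u0 \<in> W"
    and hom: "homeomorphism U' W f \<psi>" and d: "\<And>y. y \<in> W \<Longrightarrow> (\<psi> has_derivative \<psi>' y) (at y)"
    and \<psi>': "\<And>y. y \<in> W \<Longrightarrow> \<psi>' y = inv (blinfun_apply (Blinfun (?f' (\<psi> y))))"
    and bij: "\<And>y. y \<in> W \<Longrightarrow> bij (blinfun_apply (Blinfun (?f' (\<psi> y))))"
  proof (rule inverse_function_theorem[OF D(1) df contf D(2) invf])
    fix U' W g g'
    assume a: "open U'" "U' \<subseteq> U" "u0 \<in> U'" "open W" "f u0 \<in> W" "homeomorphism U' W f g"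
      "\<And>y. y \<in> W \<Longrightarrow> (g has_derivative g' y) (at y)"
      "\<And>y. y \<in> W \<Longrightarrow> g' y = inv (blinfun_apply (Blinfun (?f' (g y))))"
      "\<And>y. y \<in> W \<Longrightarrow> bij (blinfun_apply (Blinfun (?f' (g y))))"
    show thesis by (rule that[OF a])
  qed
  have im: "\<psi> ` W = U'" and left: "\<And>u. u \<in> U' \<Longrightarrow> \<psi> (f u) = u" and right: "\<And>y. y \<in> W \<Longrightarrow> f (\<psi> y) = y"
    using hom by (auto simp: homeomorphism_def)
  have in_U: "\<psi> y \<in> U" if "y \<in> W" for y using im U'(2) that by blast
  have d': "(\<psi> has_derivative inv (?f' (\<psi> y))) (at y)" and b: "bij (?f' (\<psi> y))" if "y \<in> W" for y
    using d[OF that] bij[OF that] unfolding \<psi>'[OF that] Bl[OF in_U[OF that]] .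
  have C: "Ck_on n \<psi> W" if "enat n \<le> r" for n
  proof (rule Ck_on_inverse_map[OF W(1)])
    show "\<psi> ` W \<subseteq> U'" using im by simp
    show "Ck_on n f U'" by (rule Ck_on_subset[OF f[OF that] U'(2)])
    show "inj (?f' x)" if x: "x \<in> U'" for x
    proof -
      from x[folded im] obtain y where "y \<in> W" "x = \<psi> y" by (rule imageE)
      with b show ?thesis by (simp add: bij_is_inj)
    qed
    show "continuous_on W \<psi>" using hom by (simp add: homeomorphism_def)
  qed (rule d')
  have x0: "f u0 = \<pi> x0" "\<psi> (\<pi> x0) = u0" using left[OF U'(3)] D(3) by (auto simp: f_def)
  let ?p = "\<lambda>y. q (\<psi> y)"
  have \<pi>p: "\<pi> (?p y) = y" if "y \<in> W" for y using right[OF that] by (simp add: f_def)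
  have i: "inj_on ?p W" by (rule inj_on_inverseI[of _ \<pi>]) (rule \<pi>p)
  have pW: "?p ` W = q ` U'" unfolding im[symmetric] by (rule image_image[symmetric])
  have "Cr_on r ?p W"
  proof (rule Cr_onI_open[OF W(1) _ order.refl])
    show "Ck_on n ?p W" if "enat n \<le> r" for n
      by (rule Ck_on_compose[OF W(1) _ D(7)[OF that] C[OF that]]) (use in_U in blast)
  qed
  moreover have "Cr_on r (inv_into W ?p) (?p ` W)"
  proof (rule Cr_on_subset_cong[OF _ order.refl])
    show "Cr_on r \<pi> (?p ` W)"
      by (rule Cr_onI_open[OF open_UNIV Ck_on_bounded_linear[OF open_UNIV bl Ck_on_ident[OF open_UNIV]] subset_UNIV])
    show "\<pi> x = inv_into W ?p x" if x: "x \<in> ?p ` W" for x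
    proof -
      from x obtain y where "y \<in> W" "x = ?p y" by (rule imageE)
      then show ?thesis using inv_into_f_f[OF i, of y] \<pi>p[of y] by simp
    qed
  qed
  ultimately have "Cr_parametrization r ?p W (\<pi> x0) M x0"
    using W x0 D(3) Cr_parametrization_openin[OF p U'(1,2)]
    by (intro Cr_parametrizationI i) (simp_all only: pW)
  then show thesis
  proof (rule that)
    show "\<psi> ` W \<subseteq> U" using in_U by blast
    show "\<psi> (\<pi> x0) = u0" by (rule x0(2))
    show "\<pi> (?p y) = y" if "y \<in> W" for y by (rule \<pi>p[OF that])
    show "\<psi> differentiable (at y)" if "y \<in> W" for y by (rule differentiableI[OF d[OF that]])
    show "surj (frechet_derivative \<psi> (at y))" if "y \<in> W" for y
      using bij_imp_bij_inv[OF b[OF that]] unfolding frechet_derivative_at[OF d'[OF that], symmetric] by (rule bij_is_surj)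
  qed
qed

section \<open>Iterated Grassmann images\<close>

lemma iter_immersed_level:
  fixes q :: "real^'p::finite \<Rightarrow> real^'m::finite"
  assumes p: "Cr_parametrization r q U u0 M x0" and r: "1 \<le> r" "enat k \<le> r" and l: "l < k"
  shows "immersed_level (k - Suc l) l (grassmann_iter l q) U"
  using smooth_level_iter[OF Cr_parametrizationD(1)[OF p] Cr_parametrizationD(7)[OF p r(2)] parametrization_immersion[OF p r(1)], of l] l
    Cr_parametrizationD(1)[OF p] Suc_diff_Suc[OF l]
  by (simp add: immersed_level_def)

lemma grassmann_iter_Suc_eq_iff:
  "grassmann_iter (Suc l) q u = grassmann_iter (Suc l) q' u' \<longleftrightarrow>
     grassmann_iter l q u = grassmann_iter l q' u' \<and>
     range (differential (grassmann_iter l q) u) = range (differential (grassmann_iter l q') u')"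
  by (simp add: grassmann_image_def)

lemma grassmann_iter_eq_mono:
  assumes "grassmann_iter k q u = grassmann_iter k q' u'" "l \<le> k"
  shows "grassmann_iter l q u = grassmann_iter l q' u'"
  using assms(2,1) by (induction rule: inc_induct) (auto simp only: grassmann_iter_Suc_eq_iff)

text \<open>
  By the chain rule a change of parameters composes the differentials with a surjection on the source
  side, which leaves their ranges unchanged.
\<close>

lemma grassmann_iter_reparametrize:
  fixes q :: "real^'p::finite \<Rightarrow> real^'m::finite"
  assumes p: "Cr_parametrization r q U u0 M x0" and r: "1 \<le> r" "enat k \<le> r"
    and W: "open W" "\<psi> ` W \<subseteq> U"
    and \<psi>: "\<And>y. y \<in> W \<Longrightarrow> \<psi> differentiable (at y)" "\<And>y. y \<in> W \<Longrightarrow> surj (frechet_derivative \<psi> (at y))"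
    and l: "l \<le> k" and y: "y \<in> W"
  shows "grassmann_iter l (\<lambda>y. q (\<psi> y)) y = grassmann_iter l q (\<psi> y)"
  using l y
proof (induction l arbitrary: y)
  case (Suc l)
  let ?H = "grassmann_iter l q" and ?H' = "grassmann_iter l (\<lambda>y. q (\<psi> y))"
  have im: "immersed_level (k - Suc l) l ?H U" using Suc.prems(1) by (intro iter_immersed_level[OF p r]) simp
  have IH: "?H' z = ?H (\<psi> z)" if "z \<in> W" for z using Suc.IH[of z] Suc.prems(1) that by simp
  have \<psi>y: "\<psi> y \<in> U" using W(2) Suc.prems(2) by blast
  have "differential ?H' y v c = differential ?H (\<psi> y) (frechet_derivative \<psi> (at y) v) c" for v c
  proof -
    have "((\<lambda>z. embed (?H (\<psi> z)) c) has_derivative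
        (\<lambda>v. differential ?H (\<psi> y) (frechet_derivative \<psi> (at y) v) c)) (at y)"
      using \<psi>(1)[OF Suc.prems(2)]
      by (intro has_derivative_compose[where f = \<psi> and g = "\<lambda>u. embed (?H u) c" and g' = "\<lambda>v. differential ?H (\<psi> y) v c",
            OF _ immersed_levelD(8)[OF im \<psi>y]]) (simp add: frechet_derivative_works)
    then have "((\<lambda>z. embed (?H' z) c) has_derivative
        (\<lambda>v. differential ?H (\<psi> y) (frechet_derivative \<psi> (at y) v) c)) (at y)"
      by (rule has_derivative_transform_within_open[OF _ W(1) Suc.prems(2)]) (simp add: IH)
    from fun_cong[OF frechet_derivative_at[OF this]] show ?thesis by (simp add: differential_def)
  qed
  then have "differential ?H' y = differential ?H (\<psi> y) \<circ> frechet_derivative \<psi> (at y)"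
    by (intro ext) simp
  then have "range (differential ?H' y) = range (differential ?H (\<psi> y))"
    using \<psi>(2)[OF Suc.prems(2)] by (simp only: image_comp[symmetric])
  then show ?case unfolding grassmann_iter_Suc_eq_iff using IH[OF Suc.prems(2)] by simp
qed simp

text \<open>
  The coordinate of level \<open>l\<close> that records the \<open>i\<close>-th coordinate of the underlying point of \<open>\<real>\<^sup>m\<close>.
\<close>

primrec base_coord :: "nat \<Rightarrow> 'm \<Rightarrow> 'm coord" where
  "base_coord 0 i = Base i"
| "base_coord (Suc l) i = Pull (base_coord l i)"

lemma embed_base_coord: "embed (grassmann_iter l q u) (base_coord l i) = q u $ i"
  by (induction l) (simp_all add: grassmann_image_def)

lemma differential_base_coord:
  assumes "q differentiable (at u)"
  shows "differential (grassmann_iter l q) u v (base_coord l i) = frechet_derivative q (at u) v $ i"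
proof -
  have "((\<lambda>u. q u $ i) has_derivative (\<lambda>v. frechet_derivative q (at u) v $ i)) (at u)"
    using assms by (intro bounded_linear.has_derivative[OF bounded_linear_vec_nth]) (simp add: frechet_derivative_works)
  from fun_cong[OF frechet_derivative_at[OF this]] show ?thesis
    by (simp add: differential_def embed_base_coord)
qed

text \<open>
  The base coordinates of the differential of any iterated image form the differential of \<open>q\<close>, on
  which \<open>\<pi>\<close> is a left inverse because \<open>\<pi> \<circ> q\<close> is the identity. The coefficients depend neither on the
  point nor on the parametrization, and at each level they are the matrix entries of \<open>\<pi>\<close>.
\<close>

lemma graph_differential_left_inverse:
  fixes q :: "real^'p::finite \<Rightarrow> real^'m::finite" and \<pi> :: "real^'m \<Rightarrow> real^'p"
  assumes p: "Cr_parametrization r q U u0 M x0" and r: "1 \<le> r" and \<pi>: "linear \<pi>"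
    and inv: "\<And>y. y \<in> U \<Longrightarrow> \<pi> (q y) = y" and y: "y \<in> U"
  shows "(\<Sum>i\<in>UNIV. \<pi> (axis i 1) $ k * differential (grassmann_iter l q) y v (base_coord l i)) = v $ k"
proof -
  have r1: "enat (Suc 0) \<le> r" using r by (simp add: one_enat_def)
  note d = Ck_on_SucE(1)[OF Cr_parametrizationD(7)[OF p r1] y]
  have bl: "bounded_linear \<pi>" using \<pi> by (simp add: linear_conv_bounded_linear)
  have "((\<lambda>y. y) has_derivative (\<lambda>v. \<pi> (frechet_derivative q (at y) v))) (at y)"
    by (rule has_derivative_transform_within_open[OF bounded_linear.has_derivative[OF bl d] Cr_parametrizationD(1)[OF p] y])
       (rule inv)
  from has_derivative_unique[OF this has_derivative_ident]
  have "\<pi> (frechet_derivative q (at y) v) = v" by (rule fun_cong)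
  moreover have "linear (\<lambda>w. \<pi> w $ k)"
    using linear_compose[OF \<pi> bounded_linear.linear[OF bounded_linear_vec_nth]] by (simp add: o_def)
  note linear_axis_expand[OF this, of "frechet_derivative q (at y) v"]
  ultimately show ?thesis
    using differentiableI[OF d] by (simp add: differential_base_coord mult.commute)
qed

text \<open>
  The start of the descent: the two differentials at \<open>x\<close> have equal ranges and a common left inverse,
  so they are equal.
\<close>

lemma first_order_contact:
  fixes H H' :: "real^'p::finite \<Rightarrow> 'm::finite gpoint" and e :: "'i::finite \<Rightarrow> 'm coord"
  assumes H: "immersed_level n l H U" and H': "immersed_level n l H' U" and x: "x \<in> U"
    and eq: "grassmann_image H x = grassmann_image H' x"
    and inv: "\<And>k v. (\<Sum>i\<in>UNIV. \<beta> k i * differential H x v (e i)) = v $ k"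
    and inv': "\<And>k v. (\<Sum>i\<in>UNIV. \<beta> k i * differential H' x v (e i)) = v $ k"
  shows "level_contact (Suc 0) x H H'"
  unfolding level_contact_def
proof (rule allI, rule contact_integral[OF immersed_levelD(1)[OF H] x])
  fix c v
  from eq have eq: "H x = H' x" "range (differential H x) = range (differential H' x)"
    by (simp_all add: grassmann_image_def)
  show "embed (H x) c = embed (H' x) c" using eq by simp
  show "((\<lambda>u. embed (H u) c) has_derivative (\<lambda>v. differential H u v c)) (at u)" if "u \<in> U" for u
    by (rule immersed_levelD(8)[OF H that])
  show "((\<lambda>u. embed (H' u) c) has_derivative (\<lambda>v. differential H' u v c)) (at u)" if "u \<in> U" for u
    by (rule immersed_levelD(8)[OF H' that])
  have "differential H x v \<in> range (differential H' x)" using eq(2) by blast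
  then obtain w where w: "differential H x v = differential H' x w" by blast
  have "v = w"
    unfolding vec_eq_iff using inv[of _ v] inv'[of _ w] w by simp
  moreover have "isCont (\<lambda>u. differential H u v c) x" "isCont (\<lambda>u. differential H' u v c) x"
    using Ck_on_imp_isCont[OF immersed_levelD(1)[OF H] x] immersed_levelD(3)[OF H] immersed_levelD(3)[OF H'] by blast+
  ultimately show "contact 0 x (\<lambda>u. differential H u v c) (\<lambda>u. differential H' u v c)"
    using w by (simp add: contact_0_iff)
qed

text \<open>
  The two conclusions are proved together, since the planes of the next level are compared over base
  points that have to be equal.
\<close>

lemma contact_grassmann_iter:
  fixes q q' :: "real^'p::finite \<Rightarrow> real^'m::finite"
  assumes p: "Cr_parametrization r q U u0 M x0" and p': "Cr_parametrization r q' U u0 M' x0"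
    and r: "1 \<le> r" "enat k \<le> r"
    and c: "level_contact k u0 (grassmann_iter 0 q) (grassmann_iter 0 q')" and l: "l \<le> k"
  shows "level_contact (k - l) u0 (grassmann_iter l q) (grassmann_iter l q') \<and>
    grassmann_iter l q u0 = grassmann_iter l q' u0"
  using l
proof (induction l)
  case 0
  show ?case using c Cr_parametrizationD(3)[OF p] Cr_parametrizationD(3)[OF p'] by simp
next
  case (Suc l)
  have im: "immersed_level (k - Suc l) l (grassmann_iter l q) U"
    and im': "immersed_level (k - Suc l) l (grassmann_iter l q') U"
    using Suc.prems iter_immersed_level[OF p r] iter_immersed_level[OF p' r] by simp_all
  note u0 = Cr_parametrizationD(2)[OF p]
  have c: "level_contact (Suc (k - Suc l)) u0 (grassmann_iter l q) (grassmann_iter l q')"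
    and eq: "grassmann_iter l q u0 = grassmann_iter l q' u0"
    using Suc by (simp_all add: Suc_diff_Suc)
  have "differential (grassmann_iter l q) u0 = differential (grassmann_iter l q') u0"
    by (intro ext contact_imp_eq[OF level_contact_differential[OF im im' u0 c]])
  then show ?case
    using level_contact_grassmann_image[OF im im' u0 c] eq
    unfolding grassmann_iter_Suc_eq_iff by simp
qed

text \<open>
  The order of contact and the level of the tower are exchanged one for one. The parameter \<open>j\<close> counts the
  order, so the induction descends in the tower from level \<open>k - 1\<close> to the maps themselves at \<open>j = k\<close>.
\<close>

lemma graph_contact_of_grassmann_iter_eq:
  fixes q q' :: "real^'p::finite \<Rightarrow> real^'m::finite" and \<pi> :: "real^'m \<Rightarrow> real^'p"
  assumes p: "Cr_parametrization r q U u0 M x0" and p': "Cr_parametrization r q' U u0 M' x0"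
    and r: "1 \<le> r" "enat k \<le> r" and k: "1 \<le> k" and \<pi>: "linear \<pi>"
    and inv: "\<And>y. y \<in> U \<Longrightarrow> \<pi> (q y) = y" "\<And>y. y \<in> U \<Longrightarrow> \<pi> (q' y) = y"
    and eq: "grassmann_iter k q u0 = grassmann_iter k q' u0"
    and j: "1 \<le> j" "j \<le> k"
  shows "level_contact j u0 (grassmann_iter (k - j) q) (grassmann_iter (k - j) q')"
  using j
proof (induction j rule: dec_induct)
  case base
  have l: "k - 1 < k" "Suc (k - 1) = k" using k by simp_all
  have "grassmann_image (grassmann_iter (k - 1) q) u0 = grassmann_image (grassmann_iter (k - 1) q') u0"
    using eq l(2) by (metis grassmann_iter.simps(2))
  from first_order_contact[OF iter_immersed_level[OF p r l(1)] iter_immersed_level[OF p' r l(1)]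
      Cr_parametrizationD(2)[OF p] this graph_differential_left_inverse[OF p r(1) \<pi> inv(1) Cr_parametrizationD(2)[OF p]]
      graph_differential_left_inverse[OF p' r(1) \<pi> inv(2) Cr_parametrizationD(2)[OF p]]]
  show ?case by simp
next
  case (step j)
  define l where "l = k - Suc j"
  have l: "l < k" "k - Suc l = j" "k - j = Suc l" using step.prems step.hyps by (auto simp: l_def)
  note im = iter_immersed_level[OF p r l(1), unfolded l(2)]
  note im' = iter_immersed_level[OF p' r l(1), unfolded l(2)]
  have "level_contact j u0 (grassmann_image (grassmann_iter l q)) (grassmann_image (grassmann_iter l q'))"
    using step.IH step.prems unfolding l(3) by simp
  from level_contact_of_grassmann_image[OF im im' Cr_parametrizationD(2)[OF p] this
      grassmann_iter_eq_mono[OF eq less_imp_le[OF l(1)]]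
      graph_differential_left_inverse[OF p r(1) \<pi> inv(1)] graph_differential_left_inverse[OF p' r(1) \<pi> inv(2)]]
  show ?case unfolding l_def[symmetric] .
qed

section \<open>Tangency of manifolds\<close>

lemma smallo_nhds_iff_at:
  fixes h :: "'a::euclidean_space \<Rightarrow> real"
  assumes "h x = 0"
  shows "h \<in> o[nhds x](g) \<longleftrightarrow> h \<in> o[at x](g)"
  using assms by (simp add: smallo_def eventually_nhds_conv_at)

lemma level_contact_0_iff_tangent:
  fixes q q' :: "real^'p::finite \<Rightarrow> real^'m::finite"
  assumes U: "open U" "u0 \<in> U" and c: "isCont q u0" "isCont q' u0" and eq: "q u0 = q' u0"
  shows "level_contact k u0 (grassmann_iter 0 q) (grassmann_iter 0 q') \<longleftrightarrow>
    (\<lambda>u. norm (q' u - q u)) \<in> o[at u0 within U](\<lambda>u. norm (u - u0) ^ k)"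
proof -
  let ?g = "\<lambda>u. norm (u - u0) ^ k"
  have "level_contact k u0 (grassmann_iter 0 q) (grassmann_iter 0 q') \<longleftrightarrow>
      (\<forall>i. contact k u0 (\<lambda>u. q u $ i) (\<lambda>u. q' u $ i))" (is "?L \<longleftrightarrow> ?R")
  proof
    assume ?L
    then show ?R unfolding level_contact_def
      by (intro allI) (drule spec[of _ "Base _"], simp)
  next
    assume ?R
    then have "contact k u0 (\<lambda>u. embed (grassmann_iter 0 q u) c) (\<lambda>u. embed (grassmann_iter 0 q' u) c)" for c
      by (cases c) (simp_all add: contact_refl)
    then show ?L unfolding level_contact_def by blast
  qed
  also have "\<dots> \<longleftrightarrow> (\<forall>i. (\<lambda>u. q u $ i - q' u $ i) \<in> o[at u0](?g))"
    using c eq by (simp add: contact_def smallo_nhds_iff_at)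
  also have "\<dots> \<longleftrightarrow> (\<lambda>u. norm (q' u - q u)) \<in> o[at u0](?g)"
  proof
    assume "\<forall>i. (\<lambda>u. q u $ i - q' u $ i) \<in> o[at u0](?g)"
    then have "(\<lambda>u. \<Sum>i\<in>UNIV. \<bar>q u $ i - q' u $ i\<bar>) \<in> o[at u0](?g)"
      by (intro big_sum_in_smallo) simp
    moreover have "(\<lambda>u. norm (q' u - q u)) \<in> O[at u0](\<lambda>u. \<Sum>i\<in>UNIV. \<bar>q u $ i - q' u $ i\<bar>)"
      using norm_le_l1_cart[of "q' _ - q _"]
      by (intro landau_o.bigI[of 1] always_eventually) (simp_all add: abs_minus_commute sum_nonneg)
    ultimately show "(\<lambda>u. norm (q' u - q u)) \<in> o[at u0](?g)" by (rule landau_o.big_small_trans[rotated])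
  next
    assume o: "(\<lambda>u. norm (q' u - q u)) \<in> o[at u0](?g)"
    show "\<forall>i. (\<lambda>u. q u $ i - q' u $ i) \<in> o[at u0](?g)"
    proof
      fix i
      have "(\<lambda>u. q u $ i - q' u $ i) \<in> O[at u0](\<lambda>u. norm (q' u - q u))"
        using component_le_norm_cart[of "q' _ - q _" i]
        by (intro landau_o.bigI[of 1] always_eventually) (simp_all add: abs_minus_commute)
      then show "(\<lambda>u. q u $ i - q' u $ i) \<in> o[at u0](?g)" using o by (rule landau_o.big_small_trans)
    qed
  qed
  finally show ?thesis using at_within_open[OF U(2,1)] by simp
qed

text \<open>
  The projection \<open>\<pi>\<close> is a left inverse of the differential of \<open>q\<close>. It is injective on the tangent plane of
  the other manifold as well because equality of the first Grassmann images makes the two planes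
  equal; this is where \<open>1 \<le> k\<close> is used. The centres of the two new parametrizations agree, both being \<open>\<pi> x0\<close>.
\<close>

lemma common_graph_parametrizations:
  fixes q q' :: "real^'p::finite \<Rightarrow> real^'m::finite"
  assumes p: "Cr_parametrization r q U u0 M x0" and p': "Cr_parametrization r q' U' u0' M' x0"
    and r: "1 \<le> r" "enat k \<le> r" and k: "1 \<le> k"
    and eq: "grassmann_iter k q u0 = grassmann_iter k q' u0'"
  obtains \<pi> :: "real^'m \<Rightarrow> real^'p" and N s s' where "linear \<pi>" "Cr_parametrization r s N (\<pi> x0) M x0"
    "Cr_parametrization r s' N (\<pi> x0) M' x0"
    "\<And>y. y \<in> N \<Longrightarrow> \<pi> (s y) = y" "\<And>y. y \<in> N \<Longrightarrow> \<pi> (s' y) = y"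
    "grassmann_iter k s (\<pi> x0) = grassmann_iter k s' (\<pi> x0)"
proof -
  let ?D = "frechet_derivative q (at u0)" and ?D' = "frechet_derivative q' (at u0')"
  have r1: "enat (Suc 0) \<le> r" using r by (simp add: one_enat_def)
  note d = Ck_on_SucE(1)[OF Cr_parametrizationD(7)[OF p r1] Cr_parametrizationD(2)[OF p]]
  note d' = Ck_on_SucE(1)[OF Cr_parametrizationD(7)[OF p' r1] Cr_parametrizationD(2)[OF p']]
  note inj = parametrization_immersion[OF p r(1) Cr_parametrizationD(2)[OF p]]
  note inj' = parametrization_immersion[OF p' r(1) Cr_parametrizationD(2)[OF p']]
  obtain \<pi> where \<pi>: "linear \<pi>" "\<pi> \<circ> ?D = id"
    using linear_injective_left_inverse[OF has_derivative_linear[OF d] inj] by blast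
  have \<pi>D: "\<pi> (?D v) = v" for v using fun_cong[OF \<pi>(2)] by simp
  have "grassmann_iter (Suc 0) q u0 = grassmann_iter (Suc 0) q' u0'"
    by (rule grassmann_iter_eq_mono[OF eq]) (use k in simp)
  then have rng: "range (differential (grassmann_iter 0 q) u0) = range (differential (grassmann_iter 0 q') u0')"
    unfolding grassmann_iter_Suc_eq_iff by blast
  have tangent: "\<exists>w. ?D' v = ?D w" for v
  proof -
    obtain w where w: "differential (grassmann_iter 0 q') u0' v = differential (grassmann_iter 0 q) u0 w"
      using rng by (metis rangeI imageE)
    have "?D' v $ i = ?D w $ i" for i
      using fun_cong[OF w, of "base_coord 0 i"]
      unfolding differential_base_coord[OF differentiableI[OF d]] differential_base_coord[OF differentiableI[OF d']] .
    then show ?thesis unfolding vec_eq_iff by blast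
  qed
  have "inj (\<lambda>v. \<pi> (?D v))" using \<pi>D by (simp add: inj_def)
  then obtain W \<psi> where W: "Cr_parametrization r (\<lambda>y. q (\<psi> y)) W (\<pi> x0) M x0" "\<psi> ` W \<subseteq> U" "\<psi> (\<pi> x0) = u0"
    "\<And>y. y \<in> W \<Longrightarrow> \<pi> (q (\<psi> y)) = y"
    "\<And>y. y \<in> W \<Longrightarrow> \<psi> differentiable (at y)" "\<And>y. y \<in> W \<Longrightarrow> surj (frechet_derivative \<psi> (at y))"
    using graph_reparametrization[OF p r(1) \<pi>(1)] by blast
  have "inj (\<lambda>v. \<pi> (?D' v))"
  proof (rule injI)
    fix v w assume e: "\<pi> (?D' v) = \<pi> (?D' w)"
    obtain a b where "?D' v = ?D a" "?D' w = ?D b" using tangent by blast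
    with e \<pi>D have "?D' v = ?D' w" by simp
    then show "v = w" by (rule injD[OF inj'])
  qed
  then obtain W' \<psi>' where W': "Cr_parametrization r (\<lambda>y. q' (\<psi>' y)) W' (\<pi> x0) M' x0" "\<psi>' ` W' \<subseteq> U'" "\<psi>' (\<pi> x0) = u0'"
    "\<And>y. y \<in> W' \<Longrightarrow> \<pi> (q' (\<psi>' y)) = y"
    "\<And>y. y \<in> W' \<Longrightarrow> \<psi>' differentiable (at y)" "\<And>y. y \<in> W' \<Longrightarrow> surj (frechet_derivative \<psi>' (at y))"
    using graph_reparametrization[OF p' r(1) \<pi>(1)] by blast
  note o = Cr_parametrizationD(1,2)[OF W(1)] and o' = Cr_parametrizationD(1,2)[OF W'(1)]
  have N: "open (W \<inter> W')" "\<pi> x0 \<in> W \<inter> W'" using o o' by auto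
  show thesis
  proof (rule that[OF \<pi>(1)])
    show "Cr_parametrization r (\<lambda>y. q (\<psi> y)) (W \<inter> W') (\<pi> x0) M x0"
      by (rule Cr_parametrization_subset[OF W(1) N(1) Int_lower1 N(2)])
    show "Cr_parametrization r (\<lambda>y. q' (\<psi>' y)) (W \<inter> W') (\<pi> x0) M' x0"
      by (rule Cr_parametrization_subset[OF W'(1) N(1) Int_lower2 N(2)])
    have "grassmann_iter k (\<lambda>y. q (\<psi> y)) (\<pi> x0) = grassmann_iter k q u0"
      by (subst W(3)[symmetric], rule grassmann_iter_reparametrize[OF p r o(1) W(2)]) (use W(5,6) o(2) in auto)
    moreover have "grassmann_iter k (\<lambda>y. q' (\<psi>' y)) (\<pi> x0) = grassmann_iter k q' u0'"
      by (subst W'(3)[symmetric], rule grassmann_iter_reparametrize[OF p' r o'(1) W'(2)]) (use W'(5,6) o'(2) in auto)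
    ultimately show "grassmann_iter k (\<lambda>y. q (\<psi> y)) (\<pi> x0) = grassmann_iter k (\<lambda>y. q' (\<psi>' y)) (\<pi> x0)"
      using eq by simp
  qed (simp_all add: W(4) W'(4))
qed

theorem theorem2:
  fixes M M' :: "(real^'m) set" and x0 :: "real^'m" and r :: enat and k :: nat
  assumes "1 \<le> r"
    and "embedded_manifold TYPE('p::finite) r M" and "embedded_manifold TYPE('p) r M'"
    and "x0 \<in> M \<inter> M'"
    and "1 \<le> k" and "enat k \<le> r"
  shows "tangency_order_at_least TYPE('p) r k M M' x0 \<longleftrightarrow>
    (\<exists>(u0 :: real^'p) U q q'.
       Cr_parametrization r q U u0 M x0 \<and> Cr_parametrization r q' U u0 M' x0 \<and>
       grassmann_iter k q u0 = grassmann_iter k q' u0)"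
proof -
  have tangent_iff: "level_contact k u0 (grassmann_iter 0 q) (grassmann_iter 0 q') \<longleftrightarrow>
      (\<lambda>u. norm (q' u - q u)) \<in> o[at u0 within U](\<lambda>u. norm (u - u0) ^ k)"
    if p: "Cr_parametrization r q U u0 M x0" and p': "Cr_parametrization r q' U u0 M' x0"
    for u0 :: "real^'p" and U q q'
    using Cr_parametrizationD(1-3)[OF p] Cr_parametrizationD(3)[OF p']
      Ck_on_imp_isCont[OF Cr_parametrizationD(1,2)[OF p] Cr_parametrizationD(7)[OF p \<open>enat k \<le> r\<close>]]
      Ck_on_imp_isCont[OF Cr_parametrizationD(1,2)[OF p'] Cr_parametrizationD(7)[OF p' \<open>enat k \<le> r\<close>]]
    by (intro level_contact_0_iff_tangent) simp_all
  show ?thesis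
  proof
    assume "tangency_order_at_least TYPE('p) r k M M' x0"
    then obtain u0 :: "real^'p" and U q q' where p: "Cr_parametrization r q U u0 M x0"
      and p': "Cr_parametrization r q' U u0 M' x0"
      and o: "(\<lambda>u. norm (q' u - q u)) \<in> o[at u0 within U](\<lambda>u. norm (u - u0) ^ k)"
      unfolding tangency_order_at_least_def by blast
    have "grassmann_iter k q u0 = grassmann_iter k q' u0"
      using contact_grassmann_iter[OF p p' \<open>1 \<le> r\<close> \<open>enat k \<le> r\<close> tangent_iff[OF p p', THEN iffD2, OF o] order.refl]
      by blast
    with p p' show "\<exists>(u0 :: real^'p) U q q'.
       Cr_parametrization r q U u0 M x0 \<and> Cr_parametrization r q' U u0 M' x0 \<and>
       grassmann_iter k q u0 = grassmann_iter k q' u0" by blast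
  next
    assume "\<exists>(u0 :: real^'p) U q q'.
       Cr_parametrization r q U u0 M x0 \<and> Cr_parametrization r q' U u0 M' x0 \<and>
       grassmann_iter k q u0 = grassmann_iter k q' u0"
    then obtain u0 :: "real^'p" and U q q' where p: "Cr_parametrization r q U u0 M x0"
      and p': "Cr_parametrization r q' U u0 M' x0" and e: "grassmann_iter k q u0 = grassmann_iter k q' u0"
      by blast
    obtain \<pi> :: "real^'m \<Rightarrow> real^'p" and N s s' where \<pi>: "linear \<pi>"
      and s: "Cr_parametrization r s N (\<pi> x0) M x0" and s': "Cr_parametrization r s' N (\<pi> x0) M' x0"
      and inv: "\<And>y. y \<in> N \<Longrightarrow> \<pi> (s y) = y" "\<And>y. y \<in> N \<Longrightarrow> \<pi> (s' y) = y"
      and eq: "grassmann_iter k s (\<pi> x0) = grassmann_iter k s' (\<pi> x0)"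
      by (rule common_graph_parametrizations[OF p p' \<open>1 \<le> r\<close> \<open>enat k \<le> r\<close> \<open>1 \<le> k\<close> e], rule that)
    have "level_contact k (\<pi> x0) (grassmann_iter 0 s) (grassmann_iter 0 s')"
      using graph_contact_of_grassmann_iter_eq[OF s s' \<open>1 \<le> r\<close> \<open>enat k \<le> r\<close> \<open>1 \<le> k\<close> \<pi> inv eq \<open>1 \<le> k\<close> order.refl] by simp
    then have "(\<lambda>y. norm (s' y - s y)) \<in> o[at (\<pi> x0) within N](\<lambda>y. norm (y - \<pi> x0) ^ k)"
      by (rule tangent_iff[OF s s', THEN iffD1])
    with s s' show "tangency_order_at_least TYPE('p) r k M M' x0"
      unfolding tangency_order_at_least_def
      by (intro exI[of _ "\<pi> x0"] exI[of _ N] exI[of _ s] exI[of _ s']) simp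
  qed
qed

end
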